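(* Let $L>0$ and $\Delta t>0$, and let $X_{1,\mathrm{d}}\subset X_1$ and $X_{2,\mathrm{d}}\subset X_2$ be finite-dimensional linear subspaces. Let $u^{(n)}\in X_{1,\mathrm{d}}$, and suppose that $u^{(n+1)}\in X_{1,\mathrm{d}}$ and $r^{(n+\frac12)}\in X_{2,\mathrm{d}}$ satisfy, for all $v_1\in X_{2,\mathrm{d}}$ and $v_2\in X_{1,\mathrm{d}}$, $$\left(\frac{u_x^{(n+1)}-u_x^{(n)}}{\Delta t},v_1\right)=-\frac12\left(u^{(n+\frac12)}r_x^{(n+\frac12)}+\left(u^{(n+\frac12)}r^{(n+\frac12)}\right)_x,\,v_1\right),$$ $$\left(r^{(n+\frac12)},(v_2)_x\right)=\left(u_x^{(n+\frac12)},(v_2)_x\right),$$ where $u^{(n+\frac12)}=\frac12\left(u^{(n)}+u^{(n+1)}\right)$. Then $$\int_{-L}^{L}\frac12\left(u_x^{(n+1)}\right)^2\mathrm{d}x=\int_{-L}^{L}\frac12\left(u_x^{(n)}\right)^2\mathrm{d}x .$$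
   Context: All functions are real-valued. $H^1(-L,L)$ is the usual first-order Sobolev space on $(-L,L)$ and $$X_1=\{v\in H^1(-L,L)\mid v(-L)=0\},\qquad X_2=\{v\in H^1(-L,L)\mid v(L)=0\}.$$ The bracket is $(f,g)=\int_{-L}^{L} f g\,\mathrm{d}x$, and the subscript $x$ denotes the (weak) derivative in $x$. The relations in the claim are one time step (from step $n$ to step $n+1$, $n=0,1,2,\dots$, starting from a given $u^{(0)}\in X_{1,\mathrm{d}}$) of a fully discrete Galerkin scheme for the Hunter--Saxton equation, where $u^{(n)}(\cdot)\approx u(\cdot,n\Delta t)$ and $r^{(n+\frac12)}$ is an intermediate variable. *)

theory Defs
  imports "HOL-Analysis.Analysis" "HOL-Library.Function_Algebras"
begin

text \<open>
  Elements of Lebesgue and Sobolev spaces are handled through arbitrary representatives of their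
  a.e.-equivalence classes. Representatives are total functions on the reals; their values outside
  the open set \<open>S\<close> (below always \<open>{-L<..<L}\<close>) are irrelevant.
\<close>

definition L2_space :: "real set \<Rightarrow> (real \<Rightarrow> real) set" where
  "L2_space S = {f. f \<in> borel_measurable (lebesgue_on S) \<and> integrable (lebesgue_on S) (\<lambda>x. (f x)\<^sup>2)}"

definition bracket :: "real set \<Rightarrow> (real \<Rightarrow> real) \<Rightarrow> (real \<Rightarrow> real) \<Rightarrow> real" where
  "bracket S f g = integral\<^sup>L (lebesgue_on S) (\<lambda>x. f x * g x)"

definition test_function :: "real set \<Rightarrow> (real \<Rightarrow> real) \<Rightarrow> bool" where
  "test_function S \<phi> \<longleftrightarrow>
     (\<forall>k x. (deriv ^^ k) \<phi> differentiable (at x)) \<and>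
     compact (closure {x. \<phi> x \<noteq> 0}) \<and> closure {x. \<phi> x \<noteq> 0} \<subseteq> S"

definition locally_integrable :: "real set \<Rightarrow> (real \<Rightarrow> real) \<Rightarrow> bool" where
  "locally_integrable S f \<longleftrightarrow> (\<forall>K. compact K \<and> K \<subseteq> S \<longrightarrow> f absolutely_integrable_on K)"

definition has_weak_deriv :: "real set \<Rightarrow> (real \<Rightarrow> real) \<Rightarrow> (real \<Rightarrow> real) \<Rightarrow> bool" where
  "has_weak_deriv S f g \<longleftrightarrow>
     locally_integrable S f \<and> locally_integrable S g \<and>
     (\<forall>\<phi>. test_function S \<phi> \<longrightarrow> bracket S f (deriv \<phi>) = - bracket S g \<phi>)"

text \<open>A weak derivative is unique only up to null sets; one representative is chosen.\<close>

definition weak_deriv :: "real set \<Rightarrow> (real \<Rightarrow> real) \<Rightarrow> real \<Rightarrow> real" where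
  "weak_deriv S f = (SOME g. has_weak_deriv S f g)"

definition H1_space :: "real set \<Rightarrow> (real \<Rightarrow> real) set" where
  "H1_space S = {f \<in> L2_space S. \<exists>g \<in> L2_space S. has_weak_deriv S f g}"

text \<open>
  Point values at the endpoints are those of the continuous representative on the closed interval,
  which every \<open>H\<^sup>1\<close> function has; \<open>v\<close> itself need not be continuous.
\<close>

definition has_boundary_value :: "real \<Rightarrow> (real \<Rightarrow> real) \<Rightarrow> real \<Rightarrow> real \<Rightarrow> bool" where
  "has_boundary_value L v a c \<longleftrightarrow>
     (\<exists>w. continuous_on {-L..L} w \<and> (AE x in lebesgue_on {-L<..<L}. v x = w x) \<and> w a = c)"

definition X1 :: "real \<Rightarrow> (real \<Rightarrow> real) set" where
  "X1 L = {v \<in> H1_space {-L<..<L}. has_boundary_value L v (-L) 0}"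

definition X2 :: "real \<Rightarrow> (real \<Rightarrow> real) set" where
  "X2 L = {v \<in> H1_space {-L<..<L}. has_boundary_value L v L 0}"

global_interpretation fun_space:
  vector_space "\<lambda>(c::real) (f::real \<Rightarrow> real) x. c * f x"
  by unfold_locales (auto simp: fun_eq_iff algebra_simps)

text \<open>
  A finite-dimensional subspace of a space of a.e.-equivalence classes, given as a set of
  representatives: the spanning condition is modulo null sets, so that the set may contain
  one or several representatives of each class.
\<close>

definition fin_dim_subspace :: "real set \<Rightarrow> (real \<Rightarrow> real) set \<Rightarrow> bool" where
  "fin_dim_subspace S V \<longleftrightarrow>
     fun_space.subspace V \<and>
     (\<exists>B. finite B \<and> B \<subseteq> V \<and>
        (\<forall>v\<in>V. \<exists>w\<in>fun_space.span B. AE x in lebesgue_on S. v x = w x))"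

end

theory Submission
  imports Defs "HOL-Computational_Algebra.Polynomial"
begin

text \<open>
  Write \<open>a\<close>, \<open>b\<close> for the two iterates and \<open>\<langle>f, g\<rangle>\<close> for the bracket. Since the midpoint derivative is
  \<open>(a\<^sub>x + b\<^sub>x) / 2\<close>, the difference of the two energies is \<open>\<langle>uh\<^sub>x, (b - a)\<^sub>x\<rangle>\<close>. The function
  \<open>b - a\<close> lies in the trial space, so the second relation replaces \<open>uh\<^sub>x\<close> by \<open>r\<close>; the first one,
  tested with \<open>r\<close>, turns \<open>\<langle>(b - a)\<^sub>x, r\<rangle>\<close> into a multiple of \<open>\<langle>uh r\<^sub>x + (uh r)\<^sub>x, r\<rangle>\<close>. Its
  integrand is the derivative of \<open>uh r\<^sup>2\<close>, and \<open>uh r\<^sup>2\<close> vanishes at both endpoints: \<open>uh\<close> at \<open>-L\<close> and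
  \<open>r\<close> at \<open>L\<close>. Hence the energies agree. The vanishing of the last bracket is
  \<open>advection_term_orthogonal\<close>.

  The analytic content is to make this calculation legitimate for weak derivatives, which are
  specified only through test functions and here as an arbitrarily chosen representative.

  \<^item> Weak derivatives are unique almost everywhere (\<open>weak_deriv_unique\<close>). This follows from the
    fundamental lemma of the calculus of variations, for which the smooth functions
    \<open>exp (- e / ((x - c) (d - x)))\<close> on \<open>(c, d)\<close> are used: as \<open>e\<close> tends to \<open>0\<close> they increase
    to the indicator of \<open>(c, d)\<close>, so a function orthogonal to them has integral \<open>0\<close> over every
    interval.
  \<^item> A function with an integrable weak derivative \<open>g\<close> is almost everywhere an indefinite integral
    of \<open>g\<close> (\<open>has_weak_deriv_imp_indefinite_integral\<close>), by the lemma of du Bois-Reymond; the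
    boundary values are then those of the indefinite integral.
  \<^item> Products of indefinite integrals are indefinite integrals (\<open>is_indefinite_integral_mult\<close>).
    The core is the identity of \<open>product_of_indefinite_integrals\<close>, which is Fubini's theorem on a
    square cut along its diagonal. It yields the product rule for \<open>(uh r)\<^sub>x\<close> and the integration
    of \<open>(uh r\<^sup>2)\<^sub>x\<close>.
\<close>

section \<open>Smooth bump functions\<close>

text \<open>
  The factors \<open>p\<close> and \<open>m\<close> are there so that the family is closed under differentiation: smoothness
  then needs only one first-derivative computation. Test functions are the members with \<open>p = 1\<close>
  and \<open>m = 0\<close>.
\<close>

definition bump :: "real \<Rightarrow> real \<Rightarrow> real \<Rightarrow> real poly \<Rightarrow> nat \<Rightarrow> real \<Rightarrow> real" where
  "bump e a b p m x =
     (if a < x \<and> x < b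
      then poly p x * (1 / ((x - a) * (b - x))) ^ m * exp (- e / ((x - a) * (b - x))) else 0)"

lemma power_mult_exp_bounded:
  fixes e :: real
  assumes "e > 0"
  obtains C where "C > 0" "\<And>y. y \<ge> 0 \<Longrightarrow> y ^ N * exp (- e * y) \<le> C"
proof
  \<comment> \<open>The bound compares the exponential with the term of order \<open>N\<close> of its series.\<close>
  show "fact N / e ^ N > 0"
    using assms by simp
  show "y ^ N * exp (- e * y) \<le> fact N / e ^ N" if "y \<ge> 0" for y :: real
  proof -
    have "(e * y) ^ N / fact N \<le> exp (e * y)"
      using that assms summable_exp_generic[of "e * y"] sum_le_suminf[of "\<lambda>k. (e * y) ^ k /\<^sub>R fact k" "{N}"]
      by (simp add: exp_def divide_inverse mult.commute)
    then show ?thesis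
      using assms by (simp add: exp_minus field_simps power_mult_distrib)
  qed
qed

text \<open>
  The exponential beats every power of \<open>1 / ((x - a) (b - x))\<close>, and beating it by two more powers
  than occur leaves a factor that vanishes quadratically at \<open>a\<close> and \<open>b\<close>. This forces the
  derivative to exist and to be \<open>0\<close> there.
\<close>

lemma bump_bound:
  assumes "e > 0"
  obtains C where "\<And>x. \<bar>bump e a b p m x\<bar> \<le> C * \<bar>poly p x\<bar> * ((x - a) * (b - x))\<^sup>2"
proof -
  obtain C where C: "C > 0" "\<And>y. y \<ge> 0 \<Longrightarrow> y ^ (m + 2) * exp (- e * y) \<le> C"
    using power_mult_exp_bounded[OF assms] by metis
  show thesis
  proof
    fix x
    show "\<bar>bump e a b p m x\<bar> \<le> C * \<bar>poly p x\<bar> * ((x - a) * (b - x))\<^sup>2"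
    proof (cases "a < x \<and> x < b")
      case True
      define w where "w = (x - a) * (b - x)"
      have w: "w > 0" using True by (simp add: w_def)
      have "(1 / w) ^ m * exp (- e / w) = ((1 / w) ^ (m + 2) * exp (- e * (1 / w))) * w\<^sup>2"
        using w by (simp add: power_add field_simps power2_eq_square)
      also have "\<dots> \<le> C * w\<^sup>2"
        by (rule mult_right_mono[OF C(2)]) (use w in auto)
      finally have "\<bar>poly p x\<bar> * ((1 / w) ^ m * exp (- e / w)) \<le> \<bar>poly p x\<bar> * (C * w\<^sup>2)"
        by (rule mult_left_mono) simp
      moreover have "\<bar>bump e a b p m x\<bar> = \<bar>poly p x\<bar> * ((1 / w) ^ m * exp (- e / w))"
        using True w by (simp add: bump_def w_def[symmetric] abs_mult)
      ultimately show ?thesis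
        by (simp add: w_def mult_ac)
    next
      case False
      then show ?thesis using C by (auto simp: bump_def)
    qed
  qed
qed

text \<open>
  With \<open>q = 1 / w\<close>, \<open>w = (x - a) (b - x)\<close> and \<open>s = 2 x - a - b\<close> one has \<open>q' = q\<^sup>2 s\<close>, so the derivative
  of \<open>p q\<^sup>m exp (- e q)\<close> is the product of \<open>p' w\<^sup>2 + m p s w - e p s\<close>, the power \<open>m + 2\<close> of \<open>q\<close>, and
  \<open>exp (- e q)\<close>.
\<close>

definition bump_deriv_poly :: "real \<Rightarrow> real \<Rightarrow> real \<Rightarrow> real poly \<Rightarrow> nat \<Rightarrow> real poly" where
  "bump_deriv_poly e a b p m =
     (let w = [:- a, 1:] * [:b, - 1:]; s = [:- a - b, 2:]
      in pderiv p * w\<^sup>2 + smult (of_nat m) (p * s * w) - smult e (p * s))"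

lemma bump_has_derivative:
  assumes "e > 0"
  shows "(bump e a b p m has_field_derivative bump e a b (bump_deriv_poly e a b p m) (m + 2) x) (at x)"
proof -
  consider "a < x" "x < b" | "x < a \<or> b < x" | "x = a \<or> x = b" by linarith
  then show ?thesis
  proof cases
    case 1
    define w where "w = (x - a) * (b - x)"
    have w: "w > 0" using 1 by (simp add: w_def)
    have "((\<lambda>x. poly p x * (1 / ((x - a) * (b - x))) ^ m * exp (- e / ((x - a) * (b - x))))
            has_field_derivative bump e a b (bump_deriv_poly e a b p m) (m + 2) x) (at x)"
    proof -
      have q: "((\<lambda>x. 1 / ((x - a) * (b - x))) has_field_derivative (1 / w)\<^sup>2 * (2 * x - a - b)) (at x)"
        using 1 by (auto intro!: derivative_eq_intros simp: w_def power2_eq_square)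
      have qm: "((\<lambda>x. (1 / ((x - a) * (b - x))) ^ m) has_field_derivative
              of_nat m * (1 / w) ^ (m + 1) * (2 * x - a - b)) (at x)"
        by (rule derivative_eq_intros q refl)+
          (cases m, auto simp: w_def[symmetric] power2_eq_square)
      have E: "((\<lambda>x. exp (- e * (1 / ((x - a) * (b - x))))) has_field_derivative
              exp (- e * (1 / w)) * (- e * ((1 / w)\<^sup>2 * (2 * x - a - b)))) (at x)"
        unfolding w_def by (rule DERIV_fun_exp, rule DERIV_cmult) (use q in \<open>simp add: w_def\<close>)
      have "((\<lambda>x. poly p x * (1 / ((x - a) * (b - x))) ^ m * exp (- e * (1 / ((x - a) * (b - x)))))
            has_field_derivative
          (poly (pderiv p) x * (1 / w) ^ m + poly p x * (of_nat m * (1 / w) ^ (m + 1) * (2 * x - a - b)))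
             * exp (- e * (1 / w)) +
          poly p x * (1 / w) ^ m * (exp (- e * (1 / w)) * (- e * ((1 / w)\<^sup>2 * (2 * x - a - b))))) (at x)"
        by (rule DERIV_cong[OF DERIV_mult[OF DERIV_mult[OF poly_DERIV qm] E]],
            simp only: w_def[symmetric]) (simp add: mult_ac)
      moreover have "(poly (pderiv p) x * (1 / w) ^ m + poly p x * (of_nat m * (1 / w) ^ (m + 1) * (2 * x - a - b)))
             * exp (- e * (1 / w)) +
          poly p x * (1 / w) ^ m * (exp (- e * (1 / w)) * (- e * ((1 / w)\<^sup>2 * (2 * x - a - b))))
          = bump e a b (bump_deriv_poly e a b p m) (m + 2) x"
      proof -
        define P P' s where "P = poly p x" and "P' = poly (pderiv p) x" and "s = 2 * x - a - b"
        have pD: "poly (bump_deriv_poly e a b p m) x = P' * w\<^sup>2 + of_nat m * P * s * w - e * P * s"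
          unfolding bump_deriv_poly_def Let_def w_def P_def P'_def s_def
          by (simp add: algebra_simps)
        have r: "bump e a b (bump_deriv_poly e a b p m) (m + 2) x =
            (P' * w\<^sup>2 + of_nat m * P * s * w - e * P * s) * (1 / w) ^ (m + 2) * exp (- e / w)"
          using 1 by (simp add: bump_def pD w_def)
        have l: "(P' * (1 / w) ^ m + P * (of_nat m * (1 / w) ^ (m + 1) * s)) * E +
            P * (1 / w) ^ m * (E * (- e * ((1 / w)\<^sup>2 * s)))
          = (P' * w\<^sup>2 + of_nat m * P * s * w - e * P * s) * (1 / w) ^ (m + 2) * E" for E
          using w by (simp add: power_add power2_eq_square field_simps)
        show ?thesis
          unfolding r using l[of "exp (- e / w)"] by (simp add: P_def P'_def s_def)
      qed
      ultimately show ?thesis by simp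
    qed
    then show ?thesis
      by (rule DERIV_cong_ev[THEN iffD1, rotated -1])
        (use 1 in \<open>auto simp: bump_def intro!: eventually_mono[OF
            eventually_nhds_in_open[of "{a<..<b}" x]]\<close>)
  next
    case 2
    then have ev: "eventually (\<lambda>y. bump e a b p m y = 0) (nhds x)"
    proof
      assume "x < a"
      then show ?thesis
        using eventually_nhds_in_open[of "{..<a}" x] by (auto simp: bump_def elim!: eventually_mono)
    next
      assume "b < x"
      then show ?thesis
        using eventually_nhds_in_open[of "{b<..}" x] by (auto simp: bump_def elim!: eventually_mono)
    qed
    have v: "bump e a b q k x = 0" for q k using 2 by (auto simp: bump_def)
    show ?thesis
      unfolding v by (rule DERIV_cong_ev[OF refl ev refl, THEN iffD2]) simp
  next
    case 3
    obtain C where C: "\<And>y. \<bar>bump e a b p m y\<bar> \<le> C * \<bar>poly p y\<bar> * ((y - a) * (b - y))\<^sup>2"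
      using bump_bound[OF assms] by metis
    have bx: "bump e a b q k x = 0" for q k using 3 by (auto simp: bump_def)
    have nz: "eventually (\<lambda>y. y \<noteq> x) (at x)" by (simp add: eventually_at_filter)
    have "((\<lambda>y. (bump e a b p m y - bump e a b p m x) / (y - x)) \<longlongrightarrow> 0) (at x)"
    proof (rule Lim_null_comparison)
      \<comment> \<open>\<open>z\<close> is the other endpoint, so both endpoints are treated at once.\<close>
      define z where "z = a + b - x"
      have z: "((y - a) * (b - y))\<^sup>2 = ((y - x) * (y - z))\<^sup>2" for y
        using 3 by (elim disjE) (simp_all add: z_def power2_eq_square algebra_simps)
      show "eventually (\<lambda>y. norm ((bump e a b p m y - bump e a b p m x) / (y - x))
               \<le> C * \<bar>poly p y\<bar> * (\<bar>y - x\<bar> * (y - z)\<^sup>2)) (at x)"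
        using nz
      proof eventually_elim
        case (elim y)
        have "\<bar>bump e a b p m y\<bar> / \<bar>y - x\<bar> \<le> (C * \<bar>poly p y\<bar> * ((y - x) * (y - z))\<^sup>2) / \<bar>y - x\<bar>"
          using C[of y] unfolding z by (rule divide_right_mono) simp
        also have "\<dots> = C * \<bar>poly p y\<bar> * (\<bar>y - x\<bar> * (y - z)\<^sup>2)"
        proof -
          have "((y - x) * (y - z))\<^sup>2 = \<bar>y - x\<bar> * (\<bar>y - x\<bar> * (y - z)\<^sup>2)"
            by (simp add: power_mult_distrib power2_eq_square flip: mult.assoc)
          then show ?thesis using elim by simp
        qed
        finally show ?case by (simp add: bx)
      qed
      have "((\<lambda>y. C * \<bar>poly p y\<bar> * (\<bar>y - x\<bar> * (y - z)\<^sup>2)) \<longlongrightarrow> C * \<bar>poly p x\<bar> * (\<bar>x - x\<bar> * (x - z)\<^sup>2)) (at x)"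
        by (intro tendsto_intros)
      then show "((\<lambda>y. C * \<bar>poly p y\<bar> * (\<bar>y - x\<bar> * (y - z)\<^sup>2)) \<longlongrightarrow> 0) (at x)" by simp
    qed
    then show ?thesis
      by (simp add: has_field_derivative_iff bx)
  qed
qed

lemma bump_smooth:
  assumes "e > 0"
  shows "(deriv ^^ k) (bump e a b p m) differentiable (at x)"
proof -
  have "\<exists>p' m'. (deriv ^^ k) (bump e a b p m) = bump e a b p' m'"
  proof (induction k)
    case (Suc k)
    then obtain p' m' where "(deriv ^^ k) (bump e a b p m) = bump e a b p' m'" by blast
    then have "(deriv ^^ Suc k) (bump e a b p m) = bump e a b (bump_deriv_poly e a b p' m') (m' + 2)"
      using DERIV_imp_deriv[OF bump_has_derivative[OF assms]] by (auto simp del: add_2_eq_Suc')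
    then show ?case by blast
  qed auto
  then show ?thesis
    using bump_has_derivative[OF assms] real_differentiable_def by metis
qed

lemma test_function_bump:
  assumes "e > 0" "{a..b} \<subseteq> S"
  shows "test_function S (bump e a b p m)"
proof -
  have "closure {x. bump e a b p m x \<noteq> 0} \<subseteq> {a..b}"
    by (rule closure_minimal) (auto simp: bump_def split: if_splits)
  moreover from this have "compact (closure {x. bump e a b p m x \<noteq> 0})"
    by (meson bounded_closed_interval bounded_subset closed_closure compact_eq_bounded_closed)
  ultimately show ?thesis
    unfolding test_function_def using bump_smooth[OF assms(1)] assms(2) by blast
qed

section \<open>Functions with vanishing integrals over intervals\<close>

text \<open>
  The positive and the negative part of \<open>k\<close> are densities of finite measures that agree on all
  rays, hence on all Borel sets.
\<close>

lemma AE_zero_if_integral_rays_zero: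
  fixes k :: "real \<Rightarrow> real"
  assumes k[measurable]: "integrable lborel k" and z: "\<And>x. (LINT y:{x<..}|lborel. k y) = 0"
  shows "AE x in lborel. k x = 0"
proof -
  have [measurable]: "k \<in> borel_measurable lborel" using k by auto
  define P N where "P = density lborel (\<lambda>y. ennreal (k y))" and "N = density lborel (\<lambda>y. ennreal (- k y))"
  have fin: "(\<integral>\<^sup>+y. ennreal (k y) * indicator A y \<partial>lborel) < \<infinity>"
    "(\<integral>\<^sup>+y. ennreal (- k y) * indicator A y \<partial>lborel) < \<infinity>" for A
  proof -
    have "(\<integral>\<^sup>+y. ennreal (norm (k y)) \<partial>lborel) < \<infinity>" using k by (simp add: integrable_iff_bounded)
    moreover have "(\<integral>\<^sup>+y. ennreal (k y) * indicator A y \<partial>lborel) \<le> (\<integral>\<^sup>+y. ennreal (norm (k y)) \<partial>lborel)"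
      by (intro nn_integral_mono) (auto simp: indicator_def intro: ennreal_leI)
    moreover have "(\<integral>\<^sup>+y. ennreal (- k y) * indicator A y \<partial>lborel) \<le> (\<integral>\<^sup>+y. ennreal (norm (k y)) \<partial>lborel)"
      by (intro nn_integral_mono) (auto simp: indicator_def intro: ennreal_leI)
    ultimately show "(\<integral>\<^sup>+y. ennreal (k y) * indicator A y \<partial>lborel) < \<infinity>"
    "(\<integral>\<^sup>+y. ennreal (- k y) * indicator A y \<partial>lborel) < \<infinity>" by auto
  qed
  have eq: "(\<integral>\<^sup>+y. ennreal (k y) * indicator {x<..} y \<partial>lborel) =
      (\<integral>\<^sup>+y. ennreal (- k y) * indicator {x<..} y \<partial>lborel)" for x
  proof -
    have i: "integrable lborel (\<lambda>y. indicator {x<..} y * k y)"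
      using integrable_mult_indicator[OF _ k, of "{x<..}"] by simp
    have e1: "ennreal (indicator {x<..} y * k y) = ennreal (k y) * indicator {x<..} y"
      "ennreal (- (indicator {x<..} y * k y)) = ennreal (- k y) * indicator {x<..} y" for y
      by (auto simp: indicator_def)
    have "0 = enn2real (\<integral>\<^sup>+y. ennreal (k y) * indicator {x<..} y \<partial>lborel) -
        enn2real (\<integral>\<^sup>+y. ennreal (- k y) * indicator {x<..} y \<partial>lborel)"
      using z[of x] real_lebesgue_integral_def[OF i] unfolding e1 set_lebesgue_integral_def by simp
    then have "enn2real (\<integral>\<^sup>+y. ennreal (k y) * indicator {x<..} y \<partial>lborel) =
        enn2real (\<integral>\<^sup>+y. ennreal (- k y) * indicator {x<..} y \<partial>lborel)" by linarith
    then show ?thesis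
      using fin(1)[of "{x<..}", unfolded infinity_ennreal_def, THEN ennreal_enn2real]
        fin(2)[of "{x<..}", unfolded infinity_ennreal_def, THEN ennreal_enn2real] by metis
  qed
  have "P = N"
    by (rule measure_eqI_lessThan) (auto simp: P_def N_def emeasure_density eq fin fin[unfolded infinity_ennreal_def])
  then have "AE x in lborel. ennreal (k x) = ennreal (- k x)"
    unfolding P_def N_def by (intro sigma_finite_measure.density_unique[OF sigma_finite_lborel]) auto
  then show ?thesis
  proof eventually_elim
    case (elim x)
    then show ?case by (cases "k x \<ge> 0") (auto simp: ennreal_neg ennreal_eq_0_iff)
  qed
qed

text \<open>
  Letting the interval grow to \<open>(a, b)\<close>, continuity of the indefinite integral makes the integrals
  over all rays vanish for the extension of \<open>h\<close> by \<open>0\<close>. A Borel representative of that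
  extension is subject to the criterion for rays.
\<close>

lemma AE_zero_if_interval_integrals_zero:
  fixes h :: "real \<Rightarrow> real"
  assumes h: "h absolutely_integrable_on {a..b}"
    and z: "\<And>c d. a < c \<Longrightarrow> c < d \<Longrightarrow> d < b \<Longrightarrow> integral {c..d} h = 0"
  shows "AE x in lebesgue_on {a<..<b}. h x = 0"
proof (cases "a < b")
  case False
  then show ?thesis by (simp add: AE_restrict_space_iff)
next
  case True
  have h0: "h integrable_on {a..b}" using h by (simp add: absolutely_integrable_on_def)
  \<comment> \<open>The midpoint serves as an arbitrary base point inside the interval.\<close>
  have z1: "integral {a..x} h = integral {a..(a+b)/2} h" if "a < x" "x < b" for x
  proof -
    define m where "m = (a + b) / 2"
    have m: "a < m" "m < b" using True by (auto simp: m_def)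
    have sub: "h integrable_on {a..t}" if "t < b" for t
      by (rule integrable_on_subinterval[OF h0]) (use that in auto)
    have "integral {a..x} h = integral {a..m} h"
    proof (cases x m rule: linorder_cases)
      case less
      then show ?thesis
        using Henstock_Kurzweil_Integration.integral_combine[of a x m h] sub[of m] m z[of x m] that
        by simp
    next
      case greater
      then show ?thesis
        using Henstock_Kurzweil_Integration.integral_combine[of a m x h] sub[of x] m z[of m x] that
        by simp
    qed simp
    then show ?thesis by (simp add: m_def)
  qed
  define J where "J = integral {a..(a+b)/2} h"
  have cont: "continuous_on {a..b} (\<lambda>x. integral {a..x} h)"
    by (rule indefinite_integral_continuous_1[OF h0])
  have const: "integral {a..x} h = J" if "x \<in> {a..b}" for x
  proof (rule continuous_constant_on_closure[of "{a<..<b}" "\<lambda>x. integral {a..x} h" J])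
    show "continuous_on (closure {a<..<b}) (\<lambda>x. integral {a..x} h)" using cont True by simp
    show "\<And>x. x \<in> {a<..<b} \<Longrightarrow> integral {a..x} h = J" unfolding J_def by (rule z1) auto
    show "x \<in> closure {a<..<b}" using that True by simp
  qed
  have "J = 0" using const[of a] True by simp
  define k where "k = (\<lambda>x. indicator {a..b} x * h x)"
  have k: "integrable lebesgue k" using h by (simp add: k_def set_integrable_def)
  obtain k' where k': "k' \<in> borel_measurable lborel" "AE x in lborel. k x = k' x"
    using completion_ex_borel_measurable_real[of k lborel] k by (auto dest: borel_measurable_integrable)
  have k'l: "AE x in lebesgue. k x = k' x" using k'(2) by (rule AE_completion)
  have ik': "integrable lebesgue k'"
  proof (subst integrable_cong_AE[of k' lebesgue k])
    show "k' \<in> borel_measurable lebesgue" by (rule measurable_completion[OF k'(1)])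
    show "AE x in lebesgue. k' x = k x" using k'l by eventually_elim simp
  qed (use k in \<open>simp_all add: borel_measurable_integrable\<close>)
  have ikb: "integrable lborel k'"
    using ik' integrable_completion[OF k'(1)] by simp
  have "(LINT y:{x<..}|lborel. k' y) = 0" for x
  proof -
    have "(LINT y:{x<..}|lborel. k' y) = (LINT y:{x<..}|lebesgue. k' y)"
      unfolding set_lebesgue_integral_def by (rule integral_completion[symmetric])
        (use k'(1) in \<open>intro borel_measurable_scaleR borel_measurable_indicator; simp\<close>)
    also have "\<dots> = (LINT y:{x<..}|lebesgue. k y)"
      unfolding set_lebesgue_integral_def
    proof (rule integral_cong_AE)
      have [measurable]: "k \<in> borel_measurable lebesgue" "k' \<in> borel_measurable lebesgue"
        using k ik' by (auto dest: borel_measurable_integrable)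
      show "(\<lambda>y. indicator {x<..} y *\<^sub>R k' y) \<in> borel_measurable lebesgue"
        "(\<lambda>y. indicator {x<..} y *\<^sub>R k y) \<in> borel_measurable lebesgue"
        by (intro borel_measurable_scaleR borel_measurable_indicator; simp)+
      show "AE y in lebesgue. indicator {x<..} y *\<^sub>R k' y = indicator {x<..} y *\<^sub>R k y"
        using k'l by eventually_elim simp
    qed
    also have "\<dots> = (LINT y:{a..b} \<inter> {x<..}|lebesgue. h y)"
      unfolding set_lebesgue_integral_def k_def by (rule Bochner_Integration.integral_cong) (auto simp: indicator_def)
    also have "\<dots> = integral ({a..b} \<inter> {x<..}) h"
      by (rule set_lebesgue_integral_eq_integral) (rule set_integrable_subset[OF h], auto)
    also have "\<dots> = 0"
    proof -
      consider "x < a" | "b \<le> x" | "a \<le> x" "x < b" by linarith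
      then show ?thesis
      proof cases
        case 1
        then have "{a..b} \<inter> {x<..} = {a..b}" by auto
        then show ?thesis using const[of b] True \<open>J = 0\<close> by simp
      next
        case 2
        then have "{a..b} \<inter> {x<..} = {}" by auto
        then show ?thesis by simp
      next
        case 3
        then have "integral ({a..b} \<inter> {x<..}) h = integral {x..b} h"
          by (intro integral_spike_set; intro negligible_subset[OF negligible_sing[of x]]) auto
        also have "\<dots> = integral {a..b} h - integral {a..x} h"
          using Henstock_Kurzweil_Integration.integral_combine[of a x b h] 3 h0 by simp
        finally show ?thesis using const[of b] const[of x] 3 by simp
      qed
    qed
    finally show ?thesis .
  qed
  from AE_zero_if_integral_rays_zero[OF ikb this] have "AE x in lebesgue. k' x = 0"
    by (rule AE_completion)
  with k'l have "AE x in lebesgue. k x = 0" by eventually_elim simp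
  then show ?thesis
    by (simp add: AE_restrict_space_iff) (auto simp: k_def elim!: eventually_mono)
qed

section \<open>Products of indefinite integrals\<close>

lemma absolutely_integrable_iff_integrable_lebesgue_on:
  fixes f :: "real \<Rightarrow> real"
  assumes "S \<in> sets lebesgue"
  shows "f absolutely_integrable_on S \<longleftrightarrow> integrable (lebesgue_on S) f"
  using assms by (simp add: integrable_restrict_space set_integrable_def)

lemma absolutely_integrable_continuous_times:
  fixes f g :: "real \<Rightarrow> real"
  assumes "continuous_on {a..b} f" "g absolutely_integrable_on {a..b}"
  shows "(\<lambda>x. f x * g x) absolutely_integrable_on {a..b}"
proof (rule absolutely_integrable_bounded_measurable_product_real)
  show "f \<in> borel_measurable (lebesgue_on {a..b})"
    by (rule continuous_imp_measurable_on_sets_lebesgue) (use assms in auto)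
  show "bounded (f ` {a..b})"
    by (rule compact_imp_bounded, rule compact_continuous_image) (use assms in auto)
qed (use assms in auto)

text \<open>
  The left-hand side is the integral of \<open>f s * g t\<close> over the square. The two summands on the right
  are the integrals over the triangles on either side of the diagonal, by Fubini's theorem with the
  two orders of integration.
\<close>

lemma product_of_indefinite_integrals:
  fixes f g :: "real \<Rightarrow> real"
  assumes f: "f absolutely_integrable_on {a..b}" and g: "g absolutely_integrable_on {a..b}"
  shows "integral {a..b} f * integral {a..b} g =
         integral {a..b} (\<lambda>x. f x * integral {a..x} g + integral {a..x} f * g x)"
proof -
  define M where "M = lebesgue_on {a..b}"
  interpret M: finite_measure M
    unfolding M_def using lmeasurable_cbox[of a b] by (intro finite_measure_lebesgue_on) simp
  interpret P: pair_sigma_finite M M ..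
  have ifM: "integrable M f" and igM: "integrable M g"
    using f g by (simp_all add: M_def absolutely_integrable_iff_integrable_lebesgue_on)
  then have [measurable]: "f \<in> borel_measurable M" "g \<in> borel_measurable M" by auto
  have [measurable]: "(\<lambda>x. x) \<in> borel_measurable M"
    using id_borel_measurable_lebesgue_on[of "{a..b}"] by (simp add: M_def id_def)
  have int_eq: "integral\<^sup>L M h = integral {a..b} h" if "integrable M h" for h :: "real \<Rightarrow> real"
    using that unfolding M_def by (rule lebesgue_integral_eq_integral) simp
  define H where "H = (\<lambda>(s, t). f s * g t)"
  have Hm[measurable]: "H \<in> borel_measurable (M \<Otimes>\<^sub>M M)"
    unfolding H_def by measurable
  have H: "integrable (M \<Otimes>\<^sub>M M) H"
    by (rule P.Fubini_integrable) (use ifM igM in \<open>auto simp: H_def abs_mult\<close>)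
  define H1 where "H1 = (\<lambda>(s, t). if t \<le> s then f s * g t else 0)"
  define H2 where "H2 = (\<lambda>(s, t). if s < t then f s * g t else 0)"
  have [measurable]: "H1 \<in> borel_measurable (M \<Otimes>\<^sub>M M)" "H2 \<in> borel_measurable (M \<Otimes>\<^sub>M M)"
    unfolding H1_def H2_def by measurable
  have H1: "integrable (M \<Otimes>\<^sub>M M) H1" and H2: "integrable (M \<Otimes>\<^sub>M M) H2"
    by (rule Bochner_Integration.integrable_bound[OF H]; auto simp: H_def H1_def H2_def)+
  have "integral\<^sup>L (M \<Otimes>\<^sub>M M) H = integral {a..b} f * integral {a..b} g"
    unfolding P.integral_fst'[OF H, symmetric] by (simp add: H_def int_eq ifM igM)
  moreover have "integral\<^sup>L (M \<Otimes>\<^sub>M M) H = integral\<^sup>L (M \<Otimes>\<^sub>M M) H1 + integral\<^sup>L (M \<Otimes>\<^sub>M M) H2"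
    unfolding Bochner_Integration.integral_add[OF H1 H2, symmetric]
    by (rule Bochner_Integration.integral_cong) (auto simp: H_def H1_def H2_def)
  moreover have "integral\<^sup>L (M \<Otimes>\<^sub>M M) H1 = integral {a..b} (\<lambda>s. f s * integral {a..s} g)"
  proof -
    have "integral\<^sup>L M (\<lambda>t. H1 (s, t)) = f s * integral {a..s} g" if "s \<in> {a..b}" for s
    proof -
      have i: "integrable M (\<lambda>t. if t \<in> {a..s} then g t else 0)"
        by (rule Bochner_Integration.integrable_bound[OF igM]) auto
      have "integral\<^sup>L M (\<lambda>t. H1 (s, t)) = integral\<^sup>L M (\<lambda>t. f s * (if t \<in> {a..s} then g t else 0))"
        by (rule Bochner_Integration.integral_cong) (auto simp: H1_def M_def)
      also have "\<dots> = f s * integral {a..b} (\<lambda>t. if t \<in> {a..s} then g t else 0)"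
        unfolding int_eq[OF i, symmetric] by simp
      also have "\<dots> = f s * integral ({a..s} \<inter> {a..b}) g"
        by (simp only: integral_restrict_Int)
      also have "{a..s} \<inter> {a..b} = {a..s}" using that by auto
      finally show ?thesis .
    qed
    then have "integral\<^sup>L (M \<Otimes>\<^sub>M M) H1 = integral\<^sup>L M (\<lambda>s. f s * integral {a..s} g)"
      unfolding P.integral_fst'[OF H1, symmetric]
      by (intro Bochner_Integration.integral_cong) (auto simp: M_def)
    also have "\<dots> = integral {a..b} (\<lambda>s. f s * integral {a..s} g)"
      using absolutely_integrable_continuous_times[OF indefinite_integral_continuous_1 f, of g] g
      by (intro int_eq)
        (simp add: M_def absolutely_integrable_iff_integrable_lebesgue_on[symmetric]
          absolutely_integrable_on_def mult.commute)
    finally show ?thesis .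
  qed
  moreover have "integral\<^sup>L (M \<Otimes>\<^sub>M M) H2 = integral {a..b} (\<lambda>t. integral {a..t} f * g t)"
  proof -
    have "integral\<^sup>L M (\<lambda>s. H2 (s, t)) = integral {a..t} f * g t" if "t \<in> {a..b}" for t
    proof -
      have i: "integrable M (\<lambda>s. if s \<in> {a..<t} then f s else 0)"
        by (rule Bochner_Integration.integrable_bound[OF ifM]) auto
      have "integral\<^sup>L M (\<lambda>s. H2 (s, t)) = integral\<^sup>L M (\<lambda>s. (if s \<in> {a..<t} then f s else 0) * g t)"
        by (rule Bochner_Integration.integral_cong) (auto simp: H2_def M_def)
      also have "\<dots> = integral {a..b} (\<lambda>s. if s \<in> {a..<t} then f s else 0) * g t"
        unfolding int_eq[OF i, symmetric] by simp
      also have "\<dots> = integral ({a..<t} \<inter> {a..b}) f * g t"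
        by (simp only: integral_restrict_Int)
      also have "integral ({a..<t} \<inter> {a..b}) f = integral {a..t} f"
        using that by (intro integral_spike_set; intro negligible_subset[OF negligible_sing[of t]]) auto
      finally show ?thesis .
    qed
    then have "integral\<^sup>L (M \<Otimes>\<^sub>M M) H2 = integral\<^sup>L M (\<lambda>t. integral {a..t} f * g t)"
      unfolding P.integral_snd[of "\<lambda>s t. H2 (s, t)", simplified, OF H2, symmetric]
      by (intro Bochner_Integration.integral_cong) (auto simp: M_def)
    also have "\<dots> = integral {a..b} (\<lambda>t. integral {a..t} f * g t)"
      using absolutely_integrable_continuous_times[OF indefinite_integral_continuous_1 g, of f] f
      by (intro int_eq)
        (simp add: M_def absolutely_integrable_iff_integrable_lebesgue_on[symmetric]
          absolutely_integrable_on_def)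
    finally show ?thesis .
  qed
  moreover have "integral {a..b} (\<lambda>x. f x * integral {a..x} g + integral {a..x} f * g x) =
      integral {a..b} (\<lambda>s. f s * integral {a..s} g) + integral {a..b} (\<lambda>t. integral {a..t} f * g t)"
    using absolutely_integrable_continuous_times[OF indefinite_integral_continuous_1 f, of g] g
      absolutely_integrable_continuous_times[OF indefinite_integral_continuous_1 g, of f] f
    by (intro integral_add) (simp_all add: absolutely_integrable_on_def mult.commute)
  ultimately show ?thesis by simp
qed

text \<open>
  Absolute continuity of \<open>F\<close> on the interval with derivative \<open>f\<close>, phrased by the integral so that
  pointwise derivatives never enter.
\<close>

definition is_indefinite_integral :: "real \<Rightarrow> real \<Rightarrow> (real \<Rightarrow> real) \<Rightarrow> (real \<Rightarrow> real) \<Rightarrow> bool" where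
  "is_indefinite_integral a b F f \<longleftrightarrow>
     f absolutely_integrable_on {a..b} \<and> (\<forall>x\<in>{a..b}. F x = F a + integral {a..x} f)"

lemma is_indefinite_integral_eq:
  assumes "is_indefinite_integral a b F f" "x \<in> {a..b}"
  shows "F x = F a + integral {a..x} f"
  using assms unfolding is_indefinite_integral_def by blast

lemma is_indefinite_integral_continuous_on:
  assumes "is_indefinite_integral a b F f"
  shows "continuous_on {a..b} F"
proof -
  have "continuous_on {a..b} (\<lambda>x. F a + integral {a..x} f)"
    using assms by (intro continuous_intros indefinite_integral_continuous_1)
      (simp add: is_indefinite_integral_def absolutely_integrable_on_def)
  then show ?thesis
    by (rule continuous_on_eq) (rule is_indefinite_integral_eq[OF assms, symmetric])
qed

text \<open>
  Expanding both factors at \<open>a\<close> leaves terms that are linear in the indefinite integrals and the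
  product of two indefinite integrals that vanish at \<open>a\<close>.
\<close>

lemma is_indefinite_integral_mult:
  assumes F: "is_indefinite_integral a b F f" and G: "is_indefinite_integral a b G g"
  shows "is_indefinite_integral a b (\<lambda>x. F x * G x) (\<lambda>x. G x * f x + F x * g x)"
  unfolding is_indefinite_integral_def
proof (intro conjI ballI)
  have f: "f absolutely_integrable_on {a..b}" and g: "g absolutely_integrable_on {a..b}"
    using F G by (simp_all add: is_indefinite_integral_def)
  have Gf: "(\<lambda>x. G x * f x) absolutely_integrable_on {a..b}"
    using is_indefinite_integral_continuous_on[OF G] f by (rule absolutely_integrable_continuous_times)
  have Fg: "(\<lambda>x. F x * g x) absolutely_integrable_on {a..b}"
    using is_indefinite_integral_continuous_on[OF F] g by (rule absolutely_integrable_continuous_times)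
  show "(\<lambda>x. G x * f x + F x * g x) absolutely_integrable_on {a..b}"
    using set_integral_add(1)[OF Gf Fg] .
  fix x assume x: "x \<in> {a..b}"
  have sub: "h absolutely_integrable_on {a..x}" if "h absolutely_integrable_on {a..b}" for h :: "real \<Rightarrow> real"
    by (rule set_integrable_subset[OF that]) (use x in auto)
  have fx: "f absolutely_integrable_on {a..x}" and gx: "g absolutely_integrable_on {a..x}"
    using f g sub by blast+
  define p where "p = (\<lambda>y. f y * integral {a..y} g + integral {a..y} f * g y)"
  have ci: "continuous_on {a..x} (\<lambda>y. integral {a..y} f)" "continuous_on {a..x} (\<lambda>y. integral {a..y} g)"
    using fx gx by (auto intro!: indefinite_integral_continuous_1 simp: absolutely_integrable_on_def)
  have p: "p integrable_on {a..x}"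
    unfolding p_def
    using absolutely_integrable_continuous_times[OF ci(1) gx] absolutely_integrable_continuous_times[OF ci(2) fx]
    by (intro integrable_add) (simp_all add: absolutely_integrable_on_def mult.commute)
  have "integral {a..x} (\<lambda>y. G y * f y + F y * g y) =
        integral {a..x} (\<lambda>y. (G a * f y + F a * g y) + p y)"
  proof (rule integral_cong)
    fix y assume "y \<in> {a..x}"
    then have "F y = F a + integral {a..y} f" "G y = G a + integral {a..y} g"
      using is_indefinite_integral_eq[OF F, of y] is_indefinite_integral_eq[OF G, of y] x by simp_all
    then show "G y * f y + F y * g y = (G a * f y + F a * g y) + p y"
      by (simp add: p_def algebra_simps)
  qed
  also have "\<dots> = G a * integral {a..x} f + F a * integral {a..x} g + integral {a..x} p"
    by (intro integral_unique has_integral_add has_integral_mult_right integrable_integral p)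
      (use fx gx in \<open>simp_all add: absolutely_integrable_on_def\<close>)
  also have "integral {a..x} p = integral {a..x} f * integral {a..x} g"
    unfolding p_def by (rule product_of_indefinite_integrals[OF fx gx, symmetric])
  finally show "F x * G x = F a * G a + integral {a..x} (\<lambda>y. G y * f y + F y * g y)"
    unfolding is_indefinite_integral_eq[OF F x] is_indefinite_integral_eq[OF G x]
    by (simp add: algebra_simps)
qed

section \<open>Test functions and weak derivatives\<close>

lemma AE_lebesgue_on_negligible:
  assumes "AE x in lebesgue_on S. P x" "S \<in> sets lebesgue"
  obtains N where "negligible N" "\<And>x. x \<in> S - N \<Longrightarrow> P x"
proof -
  have "AE x in lebesgue. x \<in> S \<longrightarrow> P x"
    using assms by (simp add: AE_restrict_space_iff)
  then obtain N where "N \<in> null_sets lebesgue" "{x. \<not> (x \<in> S \<longrightarrow> P x)} \<subseteq> N"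
    by (auto simp: eventually_ae_filter)
  then show thesis
    by (intro that[of N]) (auto simp: negligible_iff_null_sets)
qed

text \<open>
  Lebesgue measure is complete, so a function that is almost everywhere equal to an integrable one
  is itself measurable and integrable; if neither function is integrable then both integrals have
  the default value \<open>0\<close>.
\<close>

lemma integral_lebesgue_on_cong_AE:
  fixes p q :: "real \<Rightarrow> real"
  assumes "AE x in lebesgue_on S. p x = q x" "S \<in> sets lebesgue"
  shows "integral\<^sup>L (lebesgue_on S) p = integral\<^sup>L (lebesgue_on S) q"
    and "integrable (lebesgue_on S) p \<longleftrightarrow> integrable (lebesgue_on S) q"
proof -
  obtain N where N: "negligible N" "\<And>x. x \<in> S - N \<Longrightarrow> p x = q x"
    using AE_lebesgue_on_negligible[OF assms] by blast
  show iff: "integrable (lebesgue_on S) p \<longleftrightarrow> integrable (lebesgue_on S) q"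
    using absolutely_integrable_spike_eq[OF N(1), of S q p] N(2) assms(2)
    by (simp add: absolutely_integrable_iff_integrable_lebesgue_on)
  show "integral\<^sup>L (lebesgue_on S) p = integral\<^sup>L (lebesgue_on S) q"
  proof (cases "integrable (lebesgue_on S) p")
    case True
    with iff assms(1) show ?thesis
      by (intro integral_cong_AE) auto
  qed (use iff in \<open>simp add: not_integrable_integral_eq\<close>)
qed

lemma locally_integrable_cong_AE:
  assumes "locally_integrable S f" "AE x in lebesgue_on S. f x = g x" "S \<in> sets lebesgue"
  shows "locally_integrable S g"
proof -
  obtain N where N: "negligible N" "\<And>x. x \<in> S - N \<Longrightarrow> f x = g x"
    using AE_lebesgue_on_negligible[OF assms(2,3)] by blast
  show ?thesis
    unfolding locally_integrable_def
  proof (intro allI impI)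
    fix K assume K: "compact K \<and> K \<subseteq> S"
    show "g absolutely_integrable_on K"
      by (rule absolutely_integrable_spike[where f = f and S = N])
        (use K N assms(1) in \<open>auto simp: locally_integrable_def\<close>)
  qed
qed

lemma has_weak_deriv_cong_AE:
  assumes "has_weak_deriv S f g" "AE x in lebesgue_on S. f x = f' x" "AE x in lebesgue_on S. g x = g' x"
    and S: "S \<in> sets lebesgue"
  shows "has_weak_deriv S f' g'"
  unfolding has_weak_deriv_def
proof (intro conjI allI impI)
  show "locally_integrable S f'" "locally_integrable S g'"
    using assms locally_integrable_cong_AE unfolding has_weak_deriv_def by blast+
  fix \<phi> assume "test_function S \<phi>"
  then have "bracket S f (deriv \<phi>) = - bracket S g \<phi>"
    using assms(1) unfolding has_weak_deriv_def by blast
  moreover have "bracket S f (deriv \<phi>) = bracket S f' (deriv \<phi>)"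
    unfolding bracket_def
    by (rule integral_lebesgue_on_cong_AE(1)[OF _ S]) (use assms(2) in \<open>eventually_elim, simp\<close>)
  moreover have "bracket S g \<phi> = bracket S g' \<phi>"
    unfolding bracket_def
    by (rule integral_lebesgue_on_cong_AE(1)[OF _ S]) (use assms(3) in \<open>eventually_elim, simp\<close>)
  ultimately show "bracket S f' (deriv \<phi>) = - bracket S g' \<phi>" by simp
qed

text \<open>
  The set where two continuous functions differ is open, and nonempty open sets are not negligible.
  The endpoints follow by continuity; this is how boundary values, defined through some continuous
  representative, are transferred to a given one.
\<close>

lemma continuous_on_eq_if_AE_eq:
  fixes v w :: "real \<Rightarrow> real"
  assumes "continuous_on {a..b} v" "continuous_on {a..b} w" "a < b"
    and ae: "AE x in lebesgue_on {a<..<b}. v x = w x" and x: "x \<in> {a..b}"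
  shows "v x = w x"
proof -
  define D where "D = {a<..<b} \<inter> (\<lambda>x. v x - w x) -` (- {0})"
  have "open D"
    unfolding D_def
    by (rule continuous_open_preimage)
      (auto intro!: continuous_intros continuous_on_subset[OF assms(1)] continuous_on_subset[OF assms(2)])
  moreover have "negligible D"
  proof -
    obtain N where N: "negligible N" "\<And>x. x \<in> {a<..<b} - N \<Longrightarrow> v x = w x"
      using AE_lebesgue_on_negligible[OF ae] by auto
    show ?thesis by (rule negligible_subset[OF N(1)]) (use N(2) in \<open>auto simp: D_def\<close>)
  qed
  ultimately have "D = {}" using open_not_negligible by blast
  then have "v y - w y = 0" if "y \<in> {a<..<b}" for y using that by (auto simp: D_def)
  then have "v x - w x = 0"
    by (rule continuous_constant_on_closure[of "{a<..<b}" "\<lambda>x. v x - w x", rotated])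
      (use assms in \<open>auto intro!: continuous_intros\<close>)
  then show ?thesis by simp
qed

lemma integral_lebesgue_on_Ioo:
  fixes h :: "real \<Rightarrow> real"
  assumes "h absolutely_integrable_on {a..b}"
  shows "integrable (lebesgue_on {a<..<b}) h"
    and "integral\<^sup>L (lebesgue_on {a<..<b}) h = integral {a..b} h"
proof -
  have "h absolutely_integrable_on {a<..<b}"
    by (rule set_integrable_subset[OF assms]) auto
  then show i: "integrable (lebesgue_on {a<..<b}) h"
    by (simp add: absolutely_integrable_iff_integrable_lebesgue_on)
  show "integral\<^sup>L (lebesgue_on {a<..<b}) h = integral {a..b} h"
    using lebesgue_integral_eq_integral[OF i] by (simp add: integral_open_interval_real)
qed

lemma absolutely_integrable_on_Icc_if_integrable_Ioo:
  fixes h :: "real \<Rightarrow> real"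
  assumes "integrable (lebesgue_on {a<..<b}) h"
  shows "h absolutely_integrable_on {a..b}"
proof -
  have "h absolutely_integrable_on {a<..<b}"
    using assms by (simp add: absolutely_integrable_iff_integrable_lebesgue_on)
  moreover have "negligible {x \<in> {a<..<b} - {a..b}. h x \<noteq> 0}" "negligible {x \<in> {a..b} - {a<..<b}. h x \<noteq> 0}"
    by (rule negligible_subset[of "{a, b}"]; auto)+
  ultimately show ?thesis using absolutely_integrable_spike_set_eq by blast
qed

lemma test_function_has_deriv:
  assumes "test_function S \<phi>"
  shows "(\<phi> has_field_derivative deriv \<phi> x) (at x)"
    and "(deriv \<phi> has_field_derivative deriv (deriv \<phi>) x) (at x)"
proof -
  have "(deriv ^^ 0) \<phi> differentiable (at x)" "(deriv ^^ 1) \<phi> differentiable (at x)"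
    using assms unfolding test_function_def by blast+
  then show "(\<phi> has_field_derivative deriv \<phi> x) (at x)"
    "(deriv \<phi> has_field_derivative deriv (deriv \<phi>) x) (at x)"
    by (auto simp: DERIV_deriv_iff_real_differentiable)
qed

lemma test_function_continuous_on:
  assumes "test_function S \<phi>"
  shows "continuous_on T \<phi>" "continuous_on T (deriv \<phi>)"
  by (rule DERIV_continuous_on[OF has_field_derivative_at_within[OF test_function_has_deriv(1)[OF assms]]],
      rule DERIV_continuous_on[OF has_field_derivative_at_within[OF test_function_has_deriv(2)[OF assms]]])

lemma test_function_eq_0:
  assumes "test_function S \<phi>" "x \<notin> S"
  shows "\<phi> x = 0"
proof -
  have "{x. \<phi> x \<noteq> 0} \<subseteq> S"
    using assms(1) closure_subset order_trans unfolding test_function_def by metis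
  then show ?thesis using assms(2) by blast
qed

lemma test_function_deriv:
  assumes "test_function S \<phi>"
  shows "test_function S (deriv \<phi>)"
proof -
  have sub: "closure {x. deriv \<phi> x \<noteq> 0} \<subseteq> closure {x. \<phi> x \<noteq> 0}"
  proof (rule closure_minimal)
    show "{x. deriv \<phi> x \<noteq> 0} \<subseteq> closure {x. \<phi> x \<noteq> 0}"
    proof safe
      fix x assume x: "deriv \<phi> x \<noteq> 0"
      show "x \<in> closure {x. \<phi> x \<noteq> 0}"
      proof (rule ccontr)
        assume n: "x \<notin> closure {x. \<phi> x \<noteq> 0}"
        have "eventually (\<lambda>y. y \<in> - closure {x. \<phi> x \<noteq> 0}) (nhds x)"
          by (rule eventually_nhds_in_open) (use n in auto)
        then have "eventually (\<lambda>y. \<phi> y = 0) (nhds x)"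
          by (rule eventually_mono) (use closure_subset[of "{x. \<phi> x \<noteq> 0}"] in auto)
        then have "deriv \<phi> x = deriv (\<lambda>_. 0) x" by (rule deriv_cong_ev) simp
        then show False using x by simp
      qed
    qed
  qed simp
  have "(deriv ^^ k) (deriv \<phi>) differentiable (at x)" for k x
    using assms unfolding test_function_def by (metis funpow_Suc_right o_apply)
  moreover have "compact (closure {x. deriv \<phi> x \<noteq> 0})"
    using assms sub unfolding test_function_def
    by (meson bounded_subset closed_closure compact_eq_bounded_closed)
  ultimately show ?thesis
    using assms sub unfolding test_function_def by (meson order_trans)
qed

lemma test_function_is_indefinite_integral:
  assumes "test_function S \<phi>"
  shows "is_indefinite_integral a b \<phi> (deriv \<phi>)"
  unfolding is_indefinite_integral_def
proof (intro conjI ballI)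
  show "deriv \<phi> absolutely_integrable_on {a..b}"
    by (intro absolutely_integrable_continuous_real test_function_continuous_on[OF assms])
  fix x assume "x \<in> {a..b}"
  then have "(deriv \<phi> has_integral \<phi> x - \<phi> a) {a..x}"
    by (intro fundamental_theorem_of_calculus)
      (auto simp flip: has_real_derivative_iff_has_vector_derivative
        intro: has_field_derivative_at_within test_function_has_deriv[OF assms])
  then show "\<phi> x = \<phi> a + integral {a..x} (deriv \<phi>)"
    by (simp add: integral_unique)
qed

text \<open>
  Integration by parts against a test function: the product with a test function is an indefinite
  integral that vanishes at both endpoints.
\<close>

lemma is_indefinite_integral_has_weak_deriv:
  assumes F: "is_indefinite_integral a b F f" and "a < b"
  shows "has_weak_deriv {a<..<b} F f"
  unfolding has_weak_deriv_def
proof (intro conjI allI impI)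
  have f: "f absolutely_integrable_on {a..b}"
    using F by (simp add: is_indefinite_integral_def)
  have Fc: "continuous_on {a..b} F" by (rule is_indefinite_integral_continuous_on[OF F])
  have "h absolutely_integrable_on K" if "h absolutely_integrable_on {a..b}" "compact K \<and> K \<subseteq> {a<..<b}"
    for h :: "real \<Rightarrow> real" and K
    by (rule set_integrable_subset[OF that(1)])
      (use that(2) lmeasurable_compact[of K] in \<open>auto dest: fmeasurableD\<close>)
  then show "locally_integrable {a<..<b} f" "locally_integrable {a<..<b} F"
    unfolding locally_integrable_def using f absolutely_integrable_continuous_real[OF Fc] by blast+
  fix \<phi> assume t: "test_function {a<..<b} \<phi>"
  have p: "is_indefinite_integral a b (\<lambda>x. F x * \<phi> x) (\<lambda>x. \<phi> x * f x + F x * deriv \<phi> x)"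
    by (rule is_indefinite_integral_mult[OF F test_function_is_indefinite_integral[OF t]])
  have i1: "(\<lambda>x. \<phi> x * f x) absolutely_integrable_on {a..b}"
    by (rule absolutely_integrable_continuous_times[OF test_function_continuous_on(1)[OF t] f])
  have i2: "(\<lambda>x. F x * deriv \<phi> x) absolutely_integrable_on {a..b}"
    by (intro absolutely_integrable_continuous_real continuous_intros Fc test_function_continuous_on[OF t])
  have "0 = integral {a..b} (\<lambda>x. \<phi> x * f x + F x * deriv \<phi> x)"
    using is_indefinite_integral_eq[OF p, of b] \<open>a < b\<close> test_function_eq_0[OF t, of a] test_function_eq_0[OF t, of b]
    by simp
  also have "\<dots> = integral {a..b} (\<lambda>x. \<phi> x * f x) + integral {a..b} (\<lambda>x. F x * deriv \<phi> x)"
    using i1 i2 by (intro integral_add) (simp_all add: absolutely_integrable_on_def)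
  also have "integral {a..b} (\<lambda>x. \<phi> x * f x) = bracket {a<..<b} f \<phi>"
    unfolding bracket_def using integral_lebesgue_on_Ioo(2)[OF i1] by (simp add: mult.commute)
  also have "integral {a..b} (\<lambda>x. F x * deriv \<phi> x) = bracket {a<..<b} F (deriv \<phi>)"
    unfolding bracket_def using integral_lebesgue_on_Ioo(2)[OF i2] by simp
  finally show "bracket {a<..<b} F (deriv \<phi>) = - bracket {a<..<b} f \<phi>" by simp
qed

section \<open>The fundamental lemma and its consequences\<close>

lemma integrable_locally_integrable_times_test_function:
  assumes h: "locally_integrable S h" and t: "test_function S \<phi>" and S: "S \<in> sets lebesgue"
  shows "integrable (lebesgue_on S) (\<lambda>x. h x * \<phi> x)"
proof -
  define K where "K = closure {x. \<phi> x \<noteq> 0}"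
  have K: "compact K" "K \<subseteq> S" using t unfolding test_function_def K_def by blast+
  have Kl: "K \<in> sets lebesgue" using lmeasurable_compact[OF K(1)] by (rule fmeasurableD)
  have "(\<lambda>x. \<phi> x * h x) absolutely_integrable_on K"
  proof (rule absolutely_integrable_bounded_measurable_product_real)
    show "\<phi> \<in> borel_measurable (lebesgue_on K)"
      by (rule continuous_imp_measurable_on_sets_lebesgue[OF test_function_continuous_on(1)[OF t] Kl])
    show "bounded (\<phi> ` K)"
      by (rule compact_imp_bounded[OF compact_continuous_image[OF test_function_continuous_on(1)[OF t] K(1)]])
    show "h absolutely_integrable_on K" using h K unfolding locally_integrable_def by blast
  qed (fact Kl)
  moreover have z: "\<phi> x = 0" if "x \<notin> K" for x
    using that closure_subset[of "{x. \<phi> x \<noteq> 0}"] by (auto simp: K_def)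
  have "{x \<in> K - S. \<phi> x * h x \<noteq> 0} = {}" "{x \<in> S - K. \<phi> x * h x \<noteq> 0} = {}"
    using K(2) z by auto
  ultimately have "(\<lambda>x. \<phi> x * h x) absolutely_integrable_on S"
    using absolutely_integrable_spike_set_eq[of K S "\<lambda>x. \<phi> x * h x"] by (metis negligible_empty)
  then show ?thesis
    by (simp add: absolutely_integrable_iff_integrable_lebesgue_on[OF S] mult.commute)
qed

lemma locally_integrable_diff:
  assumes "locally_integrable S f" "locally_integrable S g"
  shows "locally_integrable S (\<lambda>x. f x - g x)"
  using assms unfolding locally_integrable_def by (metis set_integral_diff(1))

lemma bracket_diff_test_function:
  assumes "locally_integrable S f" "locally_integrable S g" "test_function S \<phi>" "S \<in> sets lebesgue"
  shows "bracket S (\<lambda>x. f x - g x) \<phi> = bracket S f \<phi> - bracket S g \<phi>"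
  unfolding bracket_def
  using integrable_locally_integrable_times_test_function[OF assms(1,3,4)]
    integrable_locally_integrable_times_test_function[OF assms(2,3,4)]
  by (simp add: left_diff_distrib)

text \<open>
  The bump functions on \<open>(c, d)\<close> with \<open>e = 1 / (k + 1)\<close> converge pointwise to \<open>1\<close> there and are
  bounded by \<open>1\<close>, so the claim follows by dominated convergence.
\<close>

lemma integral_interval_0_if_orthogonal_to_test_functions:
  assumes h: "locally_integrable S h" and z: "\<And>\<phi>. test_function S \<phi> \<Longrightarrow> bracket S h \<phi> = 0"
    and S: "S \<in> sets lebesgue" and cd: "{c..d} \<subseteq> S"
  shows "integral {c..d} h = 0"
proof -
  define \<phi> where "\<phi> k = bump (1 / real (Suc k)) c d 1 0" for k
  have t: "test_function S (\<phi> k)" for k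
    unfolding \<phi>_def by (rule test_function_bump) (use cd in auto)
  have h_int: "h absolutely_integrable_on {c..d}"
    using h cd unfolding locally_integrable_def by blast
  have i: "(\<lambda>x. h x * \<phi> k x) integrable_on {c<..<d}" for k
  proof -
    have "(\<lambda>x. h x * \<phi> k x) absolutely_integrable_on {c..d}"
      using absolutely_integrable_continuous_times[OF test_function_continuous_on(1)[OF t] h_int]
      by (simp add: mult.commute)
    then show ?thesis by (simp add: integrable_on_open_interval_real absolutely_integrable_on_def)
  qed
  have z0: "integral {c<..<d} (\<lambda>x. h x * \<phi> k x) = 0" for k
  proof -
    have "0 = integral S (\<lambda>x. h x * \<phi> k x)"
      using z[OF t] lebesgue_integral_eq_integral[OF integrable_locally_integrable_times_test_function[OF h t S] S]
      by (simp add: bracket_def)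
    also have "\<dots> = integral S (\<lambda>x. if x \<in> {c<..<d} then h x * \<phi> k x else 0)"
      by (rule integral_cong) (auto simp: \<phi>_def bump_def)
    also have "\<dots> = integral ({c<..<d} \<inter> S) (\<lambda>x. h x * \<phi> k x)"
      by (rule integral_restrict_Int)
    also have "{c<..<d} \<inter> S = {c<..<d}"
      using cd by (auto simp: subset_iff)
    finally show ?thesis by simp
  qed
  have "(\<lambda>k. integral {c<..<d} (\<lambda>x. h x * \<phi> k x)) \<longlonglongrightarrow> integral {c<..<d} h"
  proof (rule dominated_convergence(2)[OF i, of "\<lambda>x. \<bar>h x\<bar>"])
    show "(\<lambda>x. \<bar>h x\<bar>) integrable_on {c<..<d}"
      using h_int by (simp add: integrable_on_open_interval_real absolutely_integrable_on_def)
    fix x assume x: "x \<in> {c<..<d}"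
    define q where "q = 1 / ((x - c) * (d - x))"
    have q: "q > 0" using x by (simp add: q_def)
    have \<phi>x: "\<phi> k x = exp (- (1 / real (Suc k)) * q)" for k
      using x by (simp add: \<phi>_def bump_def q_def)
    have "\<phi> k x \<le> 1" "\<phi> k x \<ge> 0" for k
      unfolding \<phi>x using q by (simp_all add: field_simps)
    then show "norm (h x * \<phi> k x) \<le> \<bar>h x\<bar>" for k
      by (simp add: abs_mult mult_left_le)
    have "(\<lambda>k. h x * exp (- (1 / real (Suc k)) * q)) \<longlonglongrightarrow> h x * exp (- 0 * q)"
      by (intro tendsto_intros LIMSEQ_Suc lim_1_over_n)
    then show "(\<lambda>k. h x * \<phi> k x) \<longlonglongrightarrow> h x"
      unfolding \<phi>x by simp
  qed
  then show ?thesis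
    using LIMSEQ_unique[OF _ tendsto_const[of 0 sequentially]]
    by (simp add: z0 integral_open_interval_real)
qed

text \<open>
  As \<open>h\<close> is only locally integrable, the criterion by interval integrals is applied on each
  interval of an exhaustion of \<open>(a, b)\<close> from inside.
\<close>

lemma fundamental_lemma:
  assumes h: "locally_integrable {a<..<b} h"
    and z: "\<And>\<phi>. test_function {a<..<b} \<phi> \<Longrightarrow> bracket {a<..<b} h \<phi> = 0"
  shows "AE x in lebesgue_on {a<..<b}. h x = 0"
proof -
  define c d where "c k = a + 1 / real (Suc k)" and "d k = b - 1 / real (Suc k)" for k
  have cd: "a < c k" "d k < b" for k by (simp_all add: c_def d_def)
  have "AE x in lebesgue. x \<in> {c k<..<d k} \<longrightarrow> h x = 0" for k
  proof -
    have "h absolutely_integrable_on {c k..d k}"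
      using h cd[of k] unfolding locally_integrable_def
      by (auto elim!: allE[of _ "{c k..d k}"])
    then have "AE x in lebesgue_on {c k<..<d k}. h x = 0"
    proof (rule AE_zero_if_interval_integrals_zero)
      fix s t assume "c k < s" "s < t" "t < d k"
      then show "integral {s..t} h = 0"
        using cd[of k] by (intro integral_interval_0_if_orthogonal_to_test_functions[OF h z]) auto
    qed
    then show ?thesis by (simp add: AE_restrict_space_iff)
  qed
  then have "AE x in lebesgue. \<forall>k. x \<in> {c k<..<d k} \<longrightarrow> h x = 0"
    by (simp only: AE_all_countable) simp
  then have "AE x in lebesgue. x \<in> {a<..<b} \<longrightarrow> h x = 0"
  proof eventually_elim
    case (elim x)
    show ?case
    proof
      assume x: "x \<in> {a<..<b}"
      then have "0 < min (x - a) (b - x)" by simp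
      then obtain k where "inverse (real (Suc k)) < min (x - a) (b - x)"
        using reals_Archimedean by blast
      then have "x \<in> {c k<..<d k}" by (auto simp: c_def d_def inverse_eq_divide)
      then show "h x = 0" using elim by blast
    qed
  qed
  then show ?thesis by (simp add: AE_restrict_space_iff)
qed

lemma weak_deriv_unique:
  assumes "has_weak_deriv {a<..<b} f g" "has_weak_deriv {a<..<b} f g'"
  shows "AE x in lebesgue_on {a<..<b}. g x = g' x"
proof -
  have l: "locally_integrable {a<..<b} g" "locally_integrable {a<..<b} g'"
    using assms by (simp_all add: has_weak_deriv_def)
  have "AE x in lebesgue_on {a<..<b}. g x - g' x = 0"
  proof (rule fundamental_lemma[OF locally_integrable_diff[OF l]])
    fix \<phi> assume t: "test_function {a<..<b} \<phi>"
    have "bracket {a<..<b} g \<phi> = bracket {a<..<b} g' \<phi>"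
      using assms t unfolding has_weak_deriv_def by (metis add.inverse_inverse)
    then show "bracket {a<..<b} (\<lambda>x. g x - g' x) \<phi> = 0"
      by (simp add: bracket_diff_test_function[OF l t])
  qed
  then show ?thesis by simp
qed

lemma weak_deriv_AE_eq:
  assumes "has_weak_deriv {a<..<b} f g"
  shows "has_weak_deriv {a<..<b} f (weak_deriv {a<..<b} f)"
    and "AE x in lebesgue_on {a<..<b}. weak_deriv {a<..<b} f x = g x"
proof -
  show "has_weak_deriv {a<..<b} f (weak_deriv {a<..<b} f)"
    unfolding weak_deriv_def by (rule someI[of "has_weak_deriv {a<..<b} f", OF assms])
  then show "AE x in lebesgue_on {a<..<b}. weak_deriv {a<..<b} f x = g x"
    using assms by (rule weak_deriv_unique)
qed

lemma higher_deriv_diff_cmult: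
  assumes "\<And>k x. (deriv ^^ k) f differentiable (at x)" "\<And>k x. (deriv ^^ k) g differentiable (at x)"
  shows "(deriv ^^ k) (\<lambda>x. f x - c * g x) = (\<lambda>x. (deriv ^^ k) f x - (c::real) * (deriv ^^ k) g x)"
proof (induction k)
  case (Suc k)
  have "deriv (\<lambda>x. (deriv ^^ k) f x - c * (deriv ^^ k) g x) x =
      deriv ((deriv ^^ k) f) x - c * deriv ((deriv ^^ k) g) x" for x
  proof (rule DERIV_imp_deriv)
    have "((deriv ^^ k) f has_field_derivative deriv ((deriv ^^ k) f) x) (at x)"
      "((deriv ^^ k) g has_field_derivative deriv ((deriv ^^ k) g) x) (at x)"
      using assms by (simp_all add: DERIV_deriv_iff_real_differentiable)
    then show "((\<lambda>x. (deriv ^^ k) f x - c * (deriv ^^ k) g x) has_field_derivative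
        deriv ((deriv ^^ k) f) x - c * deriv ((deriv ^^ k) g) x) (at x)"
      by (intro DERIV_diff DERIV_cmult)
  qed
  then show ?case by (simp add: Suc fun_eq_iff)
qed simp

lemma test_function_diff_cmult:
  assumes "test_function S \<phi>" "test_function S \<psi>"
  shows "test_function S (\<lambda>x. \<phi> x - c * \<psi> x)"
proof -
  let ?K = "closure {x. \<phi> x \<noteq> 0} \<union> closure {x. \<psi> x \<noteq> 0}"
  have d: "(deriv ^^ k) \<phi> differentiable (at x)" "(deriv ^^ k) \<psi> differentiable (at x)" for k x
    using assms by (auto simp: test_function_def)
  have K: "compact ?K" "?K \<subseteq> S" using assms by (auto simp: test_function_def)
  have "closure {x. \<phi> x - c * \<psi> x \<noteq> 0} \<subseteq> ?K"
    unfolding closure_Un[symmetric] by (rule closure_mono) auto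
  moreover from this have "compact (closure {x. \<phi> x - c * \<psi> x \<noteq> 0})"
    using K(1) by (meson bounded_subset closed_closure compact_eq_bounded_closed)
  moreover have "(deriv ^^ k) (\<lambda>x. \<phi> x - c * \<psi> x) differentiable (at x)" for k x
    unfolding higher_deriv_diff_cmult[OF d] using d[of k x] by (intro derivative_intros)
  ultimately show ?thesis
    unfolding test_function_def using K(2) by blast
qed

text \<open>
  If \<open>\<psi>\<close> vanishes off \<open>[c, d]\<close>, its indefinite integral vanishes below \<open>c\<close> for trivial reasons and above
  \<open>d\<close> because the total integral is \<open>0\<close>; so it has compact support again.
\<close>

lemma test_function_antiderivative:
  assumes t: "test_function {a<..<b} \<psi>" and z: "integral {a..b} \<psi> = 0"
  obtains \<Phi> where "test_function {a<..<b} \<Phi>" "deriv \<Phi> = \<psi>"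
proof -
  define K where "K = closure {x. \<psi> x \<noteq> 0}"
  have K: "compact K" "K \<subseteq> {a<..<b}" using t by (auto simp: test_function_def K_def)
  have \<psi>0: "\<psi> x = 0" if "x \<notin> K" for x
    using that closure_subset[of "{x. \<psi> x \<noteq> 0}"] by (auto simp: K_def)
  have c: "continuous_on T \<psi>" for T by (rule test_function_continuous_on(1)[OF t])
  have ii: "\<psi> integrable_on {s..u}" for s u
    by (rule integrable_continuous_real[OF c])
  define \<Phi> where "\<Phi> x = integral {a..x} \<psi>" for x
  obtain c d where cd: "a < c" "d < b" "K \<subseteq> {c..d}"
  proof (cases "K = {}")
    case True
    \<comment> \<open>Any \<open>c > a\<close> and \<open>d < b\<close> will do; the interval from \<open>c\<close> to \<open>d\<close> may be empty.\<close>
    then show thesis by (intro that[of "a + 1" "b - 1"]) auto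
  next
    case False
    then show thesis
      using K compact_attains_inf[OF K(1)] compact_attains_sup[OF K(1)] that
      by (meson atLeastAtMost_iff greaterThanLessThan_iff subset_iff)
  qed
  have low: "\<Phi> x = 0" if "x < c" for x
  proof -
    have "integral {a..x} \<psi> = integral {a..x} (\<lambda>_. 0)"
      by (rule integral_cong, rule \<psi>0) (use that cd(3) in auto)
    then show ?thesis by (simp add: \<Phi>_def)
  qed
  have high: "\<Phi> x = 0" if "d < x" for x
  proof -
    have 0: "integral {s..u} \<psi> = 0" if "d < s" for s u
    proof -
      have "integral {s..u} \<psi> = integral {s..u} (\<lambda>_. 0)"
        by (rule integral_cong, rule \<psi>0) (use that cd(3) in auto)
      then show ?thesis by simp
    qed
    consider "x < a" | "a \<le> x" "x \<le> b" | "b < x" by linarith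
    then show ?thesis
    proof cases
      case 2
      then show ?thesis
        using Henstock_Kurzweil_Integration.integral_combine[of a x b \<psi>] ii z 0[OF that, of b]
        by (simp add: \<Phi>_def)
    next
      case 3
      show ?thesis
      proof (cases "a \<le> b")
        case True
        then show ?thesis
          using Henstock_Kurzweil_Integration.integral_combine[of a b x \<psi>] 3 ii z 0[OF cd(2), of x]
          by (simp add: \<Phi>_def)
      next
        case False
        then have "d < a" using cd(2) by simp
        then show ?thesis using 0[of a x] by (simp add: \<Phi>_def)
      qed
    qed (simp add: \<Phi>_def)
  qed
  have D: "(\<Phi> has_field_derivative \<psi> x) (at x)" for x
  proof (cases "x < c")
    case True
    have "eventually (\<lambda>y. y \<in> {..<c}) (nhds x)"
      by (rule eventually_nhds_in_open) (use True in auto)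
    then have ev: "eventually (\<lambda>y. \<Phi> y = 0) (nhds x)"
      by eventually_elim (simp add: low)
    have "x \<notin> K" using True cd(3) by auto
    then have "\<psi> x = 0" by (rule \<psi>0)
    then show ?thesis
      using DERIV_cong_ev[OF refl ev refl, THEN iffD2, OF DERIV_const] by simp
  next
    case False
    have "((\<lambda>u. integral {a..u} \<psi>) has_real_derivative \<psi> x) (at x within {a..x + 1})"
      by (rule integral_has_real_derivative[OF c]) (use False cd(1) in auto)
    moreover have "at x within {a..x + 1} = at x"
      by (rule at_within_Icc_at) (use False cd(1) in auto)
    ultimately show ?thesis by (simp add: \<Phi>_def[abs_def])
  qed
  have deriv\<Phi>: "deriv \<Phi> = \<psi>"
    using DERIV_imp_deriv[OF D] by blast
  have "(deriv ^^ k) \<Phi> differentiable (at x)" for k x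
  proof (cases k)
    case 0
    then show ?thesis using D[of x] by (auto simp: real_differentiable_def)
  next
    case (Suc j)
    have "(deriv ^^ Suc j) \<Phi> = (deriv ^^ j) \<psi>"
      by (simp only: funpow_Suc_right o_apply deriv\<Phi>)
    then show ?thesis using Suc t by (simp only: test_function_def)
  qed
  moreover have "{x. \<Phi> x \<noteq> 0} \<subseteq> {c..d}"
    using low high by (metis (mono_tags) atLeastAtMost_iff mem_Collect_eq not_le subsetI)
  then have "closure {x. \<Phi> x \<noteq> 0} \<subseteq> {c..d}"
    by (rule closure_minimal) simp
  moreover from this have "compact (closure {x. \<Phi> x \<noteq> 0})"
    by (meson bounded_closed_interval bounded_subset closed_closure compact_eq_bounded_closed)
  moreover have "{c..d} \<subseteq> {a<..<b}" using cd by auto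
  ultimately have "test_function {a<..<b} \<Phi>"
    unfolding test_function_def by blast
  then show thesis using deriv\<Phi> by (rule that)
qed

text \<open>
  Fix a test function \<open>\<psi>\<close> with nonzero integral. For every test function \<open>\<phi>\<close> a suitable
  \<open>\<phi> - \<alpha> \<psi>\<close> has integral \<open>0\<close>, so it is the derivative of a test function and orthogonal to \<open>h\<close>. This
  says that \<open>h - c\<close> is orthogonal to \<open>\<phi>\<close> for a constant \<open>c\<close> that depends on \<open>\<psi>\<close> only, and the
  fundamental lemma applies.
\<close>

lemma du_Bois_Reymond:
  assumes h: "locally_integrable {a<..<b} h" and "a < b"
    and z: "\<And>\<phi>. test_function {a<..<b} \<phi> \<Longrightarrow> bracket {a<..<b} h (deriv \<phi>) = 0"
  obtains c where "AE x in lebesgue_on {a<..<b}. h x = c"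
proof -
  let ?S = "{a<..<b}"
  have S: "?S \<in> sets lebesgue" by simp
  obtain s u where su: "a < s" "s < u" "u < b"
    using \<open>a < b\<close> dense by meson
  define \<psi> where "\<psi> = bump 1 s u 1 0"
  have t\<psi>: "test_function ?S \<psi>"
    unfolding \<psi>_def by (rule test_function_bump) (use su in auto)
  have i: "\<phi> absolutely_integrable_on {a..b}" if "test_function ?S \<phi>" for \<phi>
    by (intro absolutely_integrable_continuous_real test_function_continuous_on(1)[OF that])
  have "integral {a..b} \<psi> \<noteq> 0"
  proof
    assume "integral {a..b} \<psi> = 0"
    moreover have "\<psi> x \<ge> 0" for x
      by (auto simp: \<psi>_def bump_def)
    moreover have "(s + u) / 2 \<in> {a..b}" using su by simp
    ultimately have "\<psi> ((s + u) / 2) = 0"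
      using integral_eq_0_iff[OF test_function_continuous_on(1)[OF t\<psi>] \<open>a < b\<close>] by blast
    then show False using su by (simp add: \<psi>_def bump_def)
  qed
  define c where "c = bracket ?S h \<psi> / integral {a..b} \<psi>"
  have lc: "locally_integrable ?S (\<lambda>_. c)"
    unfolding locally_integrable_def
  proof (intro allI impI)
    fix K assume "compact K \<and> K \<subseteq> ?S"
    then show "(\<lambda>_. c) absolutely_integrable_on K"
      using lmeasurable_compact[of K] by (simp add: absolutely_integrable_on_const)
  qed
  have "AE x in lebesgue_on ?S. h x - c = 0"
  proof (rule fundamental_lemma[OF locally_integrable_diff[OF h lc]])
    fix \<phi> assume t: "test_function ?S \<phi>"
    define \<alpha> where "\<alpha> = integral {a..b} \<phi> / integral {a..b} \<psi>"
    have t\<chi>: "test_function ?S (\<lambda>x. \<phi> x - \<alpha> * \<psi> x)"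
      by (rule test_function_diff_cmult[OF t t\<psi>])
    have "integral {a..b} (\<lambda>x. \<phi> x - \<alpha> * \<psi> x) = integral {a..b} \<phi> - \<alpha> * integral {a..b} \<psi>"
      using i[OF t] i[OF t\<psi>]
      by (intro integral_unique has_integral_diff has_integral_mult_right integrable_integral)
        (simp_all add: absolutely_integrable_on_def)
    then have "integral {a..b} (\<lambda>x. \<phi> x - \<alpha> * \<psi> x) = 0"
      using \<open>integral {a..b} \<psi> \<noteq> 0\<close> by (simp add: \<alpha>_def)
    then obtain \<Phi> where \<Phi>: "test_function ?S \<Phi>" "deriv \<Phi> = (\<lambda>x. \<phi> x - \<alpha> * \<psi> x)"
      using test_function_antiderivative[OF t\<chi>] by blast
    have ih: "integrable (lebesgue_on ?S) (\<lambda>x. h x * \<phi> x)" "integrable (lebesgue_on ?S) (\<lambda>x. h x * \<psi> x)"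
      by (rule integrable_locally_integrable_times_test_function[OF h _ S]; fact)+
    have "0 = bracket ?S h (\<lambda>x. \<phi> x - \<alpha> * \<psi> x)"
      using z[OF \<Phi>(1)] by (simp add: \<Phi>(2))
    also have "\<dots> = integral\<^sup>L (lebesgue_on ?S) (\<lambda>x. h x * \<phi> x - \<alpha> * (h x * \<psi> x))"
      unfolding bracket_def by (rule Bochner_Integration.integral_cong) (auto simp: algebra_simps)
    also have "\<dots> = bracket ?S h \<phi> - \<alpha> * bracket ?S h \<psi>"
      using ih by (simp add: bracket_def)
    also have "\<alpha> * bracket ?S h \<psi> = c * integral {a..b} \<phi>"
      by (simp add: \<alpha>_def c_def)
    also have "\<dots> = bracket ?S (\<lambda>_. c) \<phi>"
      using integral_lebesgue_on_Ioo[OF i[OF t]] by (simp add: bracket_def)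
    finally show "bracket ?S (\<lambda>x. h x - c) \<phi> = 0"
      by (simp add: bracket_diff_test_function[OF h lc t])
  qed
  then show thesis by (intro that[of c]) simp
qed

text \<open>
  The indefinite integral of \<open>g\<close> has the weak derivative \<open>g\<close> as well, so its difference to \<open>f\<close> is
  orthogonal to all derivatives of test functions and therefore constant.
\<close>

lemma has_weak_deriv_imp_indefinite_integral:
  assumes w: "has_weak_deriv {a<..<b} f g" and g: "integrable (lebesgue_on {a<..<b}) g" and "a < b"
  obtains F where "is_indefinite_integral a b F g" "AE x in lebesgue_on {a<..<b}. f x = F x"
proof -
  let ?S = "{a<..<b}"
  have ga: "g absolutely_integrable_on {a..b}"
    using g by (rule absolutely_integrable_on_Icc_if_integrable_Ioo)
  define G where "G c x = c + integral {a..x} g" for c x :: real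
  have G: "is_indefinite_integral a b (G c) g" for c
    using ga by (simp add: is_indefinite_integral_def G_def)
  have wG: "has_weak_deriv ?S (G 0) g"
    by (rule is_indefinite_integral_has_weak_deriv[OF G \<open>a < b\<close>])
  have l: "locally_integrable ?S f" "locally_integrable ?S (G 0)"
    using w wG by (simp_all add: has_weak_deriv_def)
  obtain c where "AE x in lebesgue_on ?S. f x - G 0 x = c"
  proof (rule du_Bois_Reymond[OF locally_integrable_diff[OF l] \<open>a < b\<close>])
    fix \<phi> assume t: "test_function ?S \<phi>"
    have "bracket ?S f (deriv \<phi>) = bracket ?S (G 0) (deriv \<phi>)"
      using w wG t unfolding has_weak_deriv_def by simp
    then show "bracket ?S (\<lambda>x. f x - G 0 x) (deriv \<phi>) = 0"
      by (simp add: bracket_diff_test_function[OF l test_function_deriv[OF t]])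
  qed
  then have "AE x in lebesgue_on ?S. f x = G c x"
    by eventually_elim (simp add: G_def)
  with G show thesis by (rule that)
qed

lemma L2_integrable_mult:
  assumes "f \<in> L2_space S" "g \<in> L2_space S"
  shows "integrable (lebesgue_on S) (\<lambda>x. f x * g x)"
proof (rule Bochner_Integration.integrable_bound)
  show "integrable (lebesgue_on S) (\<lambda>x. (f x)\<^sup>2 + (g x)\<^sup>2)"
    using assms by (simp add: L2_space_def)
  show "(\<lambda>x. f x * g x) \<in> borel_measurable (lebesgue_on S)"
    using assms by (auto simp: L2_space_def)
  have "\<bar>f x * g x\<bar> \<le> (f x)\<^sup>2 + (g x)\<^sup>2" for x
  proof -
    have "2 * (\<bar>f x\<bar> * \<bar>g x\<bar>) \<le> (f x)\<^sup>2 + (g x)\<^sup>2"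
      using sum_squares_bound[of "\<bar>f x\<bar>" "\<bar>g x\<bar>"] by simp
    moreover have "0 \<le> \<bar>f x\<bar> * \<bar>g x\<bar>" by simp
    ultimately show ?thesis unfolding abs_mult by linarith
  qed
  then show "AE x in lebesgue_on S. norm (f x * g x) \<le> norm ((f x)\<^sup>2 + (g x)\<^sup>2)"
    by simp
qed

lemma L2_integrable:
  assumes "f \<in> L2_space {a<..<b}"
  shows "integrable (lebesgue_on {a<..<b}) f"
proof -
  have "(\<lambda>_. 1 :: real) absolutely_integrable_on {a..b}"
    by (intro absolutely_integrable_continuous_real continuous_intros)
  then have "(\<lambda>_. 1) \<in> L2_space {a<..<b}"
    using integral_lebesgue_on_Ioo(1) by (simp add: L2_space_def)
  from L2_integrable_mult[OF assms this] show ?thesis by simp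
qed

lemma L2_space_cong_AE:
  assumes "f \<in> L2_space S" "AE x in lebesgue_on S. f x = g x" "S \<in> sets lebesgue"
    and "g \<in> borel_measurable (lebesgue_on S)"
  shows "g \<in> L2_space S"
proof -
  have "AE x in lebesgue_on S. (f x)\<^sup>2 = (g x)\<^sup>2"
    using assms(2) by eventually_elim simp
  from integral_lebesgue_on_cong_AE(2)[OF this assms(3)] show ?thesis
    using assms(1,4) by (simp add: L2_space_def)
qed

text \<open>
  Membership in the Sobolev space provides some square-integrable weak derivative; by uniqueness
  the representative that \<open>weak_deriv\<close> selects inherits square-integrability.
\<close>

lemma H1_space_has_weak_deriv:
  assumes f: "f \<in> H1_space {a<..<b}"
  shows "has_weak_deriv {a<..<b} f (weak_deriv {a<..<b} f)"
    and "weak_deriv {a<..<b} f \<in> L2_space {a<..<b}"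
proof -
  let ?S = "{a<..<b}"
  obtain g where g: "g \<in> L2_space ?S" "has_weak_deriv ?S f g"
    using f by (auto simp: H1_space_def)
  show "has_weak_deriv ?S f (weak_deriv ?S f)" by (rule weak_deriv_AE_eq(1)[OF g(2)])
  have ae: "AE x in lebesgue_on ?S. g x = weak_deriv ?S f x"
    using weak_deriv_AE_eq(2)[OF g(2)] by eventually_elim simp
  have "integrable (lebesgue_on ?S) (weak_deriv ?S f)"
    using integral_lebesgue_on_cong_AE(2)[OF ae] L2_integrable[OF g(1)] by simp
  then show "weak_deriv ?S f \<in> L2_space ?S"
    by (intro L2_space_cong_AE[OF g(1) ae]) auto
qed

lemma H1_space_indefinite_integral:
  assumes f: "f \<in> H1_space {-L<..<L}" and v: "has_boundary_value L f e c"
    and "L > 0" and e: "e \<in> {-L..L}"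
  obtains F where "is_indefinite_integral (-L) L F (weak_deriv {-L<..<L} f)"
    "AE x in lebesgue_on {-L<..<L}. f x = F x" "F e = c"
proof -
  obtain F where F: "is_indefinite_integral (-L) L F (weak_deriv {-L<..<L} f)"
    "AE x in lebesgue_on {-L<..<L}. f x = F x"
    using has_weak_deriv_imp_indefinite_integral[OF H1_space_has_weak_deriv(1)[OF f]
        L2_integrable[OF H1_space_has_weak_deriv(2)[OF f]]] \<open>L > 0\<close> by auto
  obtain w where w: "continuous_on {-L..L} w" "AE x in lebesgue_on {-L<..<L}. f x = w x" "w e = c"
    using v by (auto simp: has_boundary_value_def)
  have "AE x in lebesgue_on {-L<..<L}. F x = w x"
    using F(2) w(2) by eventually_elim simp
  then have "F e = w e"
    using continuous_on_eq_if_AE_eq[OF is_indefinite_integral_continuous_on[OF F(1)] w(1) _ _ e] \<open>L > 0\<close>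
    by simp
  with w(3) show thesis by (intro that[OF F]) simp
qed

lemma has_weak_deriv_lincomb:
  assumes f: "has_weak_deriv S f f'" and g: "has_weak_deriv S g g'" and S: "S \<in> sets lebesgue"
  shows "has_weak_deriv S (\<lambda>x. c * f x + d * g x) (\<lambda>x. c * f' x + d * g' x)"
  unfolding has_weak_deriv_def
proof (intro conjI allI impI)
  have l: "locally_integrable S f" "locally_integrable S f'" "locally_integrable S g" "locally_integrable S g'"
    using f g by (simp_all add: has_weak_deriv_def)
  have "locally_integrable S (\<lambda>x. c * p x + d * q x)" if "locally_integrable S p" "locally_integrable S q"
    for p q
    using that unfolding locally_integrable_def
    by (intro allI impI set_integral_add(1)) (auto intro: set_integrable_mult_right)
  with l show "locally_integrable S (\<lambda>x. c * f x + d * g x)" "locally_integrable S (\<lambda>x. c * f' x + d * g' x)"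
    by blast+
  have lin: "bracket S (\<lambda>x. c * p x + d * q x) \<phi> = c * bracket S p \<phi> + d * bracket S q \<phi>"
    if "locally_integrable S p" "locally_integrable S q" "test_function S \<phi>" for p q \<phi>
  proof -
    have "bracket S (\<lambda>x. c * p x + d * q x) \<phi> =
        integral\<^sup>L (lebesgue_on S) (\<lambda>x. c * (p x * \<phi> x) + d * (q x * \<phi> x))"
      unfolding bracket_def by (rule Bochner_Integration.integral_cong) (auto simp: algebra_simps)
    then show ?thesis
      using integrable_locally_integrable_times_test_function[OF that(1,3) S]
        integrable_locally_integrable_times_test_function[OF that(2,3) S]
      by (simp add: bracket_def)
  qed
  fix \<phi> assume t: "test_function S \<phi>"
  have "bracket S f (deriv \<phi>) = - bracket S f' \<phi>" "bracket S g (deriv \<phi>) = - bracket S g' \<phi>"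
    using f g t by (simp_all add: has_weak_deriv_def)
  then show "bracket S (\<lambda>x. c * f x + d * g x) (deriv \<phi>) = - bracket S (\<lambda>x. c * f' x + d * g' x) \<phi>"
    by (simp add: lin[OF l(1,3) test_function_deriv[OF t]] lin[OF l(2,4) t])
qed

lemma weak_deriv_lincomb:
  assumes f: "f \<in> H1_space {a<..<b}" and g: "g \<in> H1_space {a<..<b}"
  shows "AE x in lebesgue_on {a<..<b}. weak_deriv {a<..<b} (\<lambda>y. c * f y + d * g y) x =
           c * weak_deriv {a<..<b} f x + d * weak_deriv {a<..<b} g x"
  by (rule weak_deriv_AE_eq(2))
    (rule has_weak_deriv_lincomb[OF H1_space_has_weak_deriv(1)[OF f] H1_space_has_weak_deriv(1)[OF g]], simp)


section \<open>Conservation of the energy\<close>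

text \<open>
  Almost everywhere the integrand equals \<open>(u r\<^sup>2)\<^sub>x\<close>: with \<open>(u r)\<^sub>x = u\<^sub>x r + u r\<^sub>x\<close> both are
  \<open>u\<^sub>x r\<^sup>2 + 2 u r r\<^sub>x\<close>. Its integral is the difference of the boundary values of \<open>u r\<^sup>2\<close>, of which the
  one at \<open>-L\<close> vanishes through \<open>u\<close> and the one at \<open>L\<close> through \<open>r\<close>.
\<close>

lemma advection_term_orthogonal:
  assumes u: "u \<in> X1 L" and r: "r \<in> X2 L" and "L > 0"
  defines "I \<equiv> {-L<..<L}"
  shows "bracket I (\<lambda>x. u x * weak_deriv I r x + weak_deriv I (\<lambda>y. u y * r y) x) r = 0"
proof -
  have I: "I \<in> sets lebesgue" by (simp add: I_def)
  have uH: "u \<in> H1_space {-L<..<L}" "has_boundary_value L u (-L) 0"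
    and rH: "r \<in> H1_space {-L<..<L}" "has_boundary_value L r L 0"
    using u r by (simp_all add: X1_def X2_def)
  have ends: "-L \<in> {-L..L}" "L \<in> {-L..L}" using \<open>L > 0\<close> by simp_all
  obtain U where U: "is_indefinite_integral (-L) L U (weak_deriv I u)"
    "AE x in lebesgue_on I. u x = U x" "U (-L) = 0"
    using H1_space_indefinite_integral[OF uH \<open>L > 0\<close> ends(1), folded I_def] by blast
  obtain R where R: "is_indefinite_integral (-L) L R (weak_deriv I r)"
    "AE x in lebesgue_on I. r x = R x" "R L = 0"
    using H1_space_indefinite_integral[OF rH \<open>L > 0\<close> ends(2), folded I_def] by blast
  define p where "p = (\<lambda>x. R x * weak_deriv I u x + U x * weak_deriv I r x)"
  have P: "is_indefinite_integral (-L) L (\<lambda>x. U x * R x) p"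
    unfolding p_def by (rule is_indefinite_integral_mult[OF U(1) R(1)])
  have ae: "AE x in lebesgue_on I. U x * R x = u x * r x"
    using U(2) R(2) by eventually_elim simp
  have "has_weak_deriv I (\<lambda>x. U x * R x) p"
    unfolding I_def using P by (rule is_indefinite_integral_has_weak_deriv) (use \<open>L > 0\<close> in simp)
  then have "has_weak_deriv I (\<lambda>y. u y * r y) p"
    using ae by (rule has_weak_deriv_cong_AE) (use I in simp_all)
  then have p: "AE x in lebesgue_on I. weak_deriv I (\<lambda>y. u y * r y) x = p x"
    unfolding I_def by (rule weak_deriv_AE_eq(2))
  \<comment> \<open>The derivative of \<open>(U R) R\<close> by a second use of the product rule.\<close>
  define q where "q = (\<lambda>x. R x * p x + U x * R x * weak_deriv I r x)"
  have Q: "is_indefinite_integral (-L) L (\<lambda>x. U x * R x * R x) q"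
    unfolding q_def by (rule is_indefinite_integral_mult[OF P R(1)])
  have "bracket I (\<lambda>x. u x * weak_deriv I r x + weak_deriv I (\<lambda>y. u y * r y) x) r =
      integral\<^sup>L (lebesgue_on I) q"
    unfolding bracket_def
  proof (rule integral_lebesgue_on_cong_AE(1)[OF _ I])
    show "AE x in lebesgue_on I. (u x * weak_deriv I r x + weak_deriv I (\<lambda>y. u y * r y) x) * r x = q x"
      using U(2) R(2) p by eventually_elim (simp add: q_def algebra_simps)
  qed
  also have "\<dots> = integral {-L..L} q"
    unfolding I_def using Q by (intro integral_lebesgue_on_Ioo(2)) (simp add: is_indefinite_integral_def)
  also have "\<dots> = 0"
    using is_indefinite_integral_eq[OF Q, of L] \<open>L > 0\<close> U(3) R(3) by simp
  finally show ?thesis .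
qed

theorem proposition4:
  fixes L dt :: real and X1d X2d :: "(real \<Rightarrow> real) set"
    and u :: "nat \<Rightarrow> real \<Rightarrow> real" and n :: nat and uh r :: "real \<Rightarrow> real"
  defines "I \<equiv> {-L<..<L}"
  assumes "L > 0" and "dt > 0"
    and "X1d \<subseteq> X1 L" and "fin_dim_subspace I X1d"
    and "X2d \<subseteq> X2 L" and "fin_dim_subspace I X2d"
    and "u n \<in> X1d" and "u (Suc n) \<in> X1d" and "r \<in> X2d"
    and uh: "uh = (\<lambda>x. 1/2 * (u n x + u (Suc n) x))"
    and "\<And>v1. v1 \<in> X2d \<Longrightarrow>
      bracket I (\<lambda>x. (weak_deriv I (u (Suc n)) x - weak_deriv I (u n) x) / dt) v1 =
      - 1/2 * bracket I (\<lambda>x. uh x * weak_deriv I r x + weak_deriv I (\<lambda>y. uh y * r y) x) v1"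
    and "\<And>v2. v2 \<in> X1d \<Longrightarrow>
      bracket I r (weak_deriv I v2) = bracket I (weak_deriv I uh) (weak_deriv I v2)"
  shows "integral\<^sup>L (lebesgue_on I) (\<lambda>x. 1/2 * (weak_deriv I (u (Suc n)) x)\<^sup>2) =
         integral\<^sup>L (lebesgue_on I) (\<lambda>x. 1/2 * (weak_deriv I (u n) x)\<^sup>2)"
proof -
  note evolution = assms(12) and projection = assms(13)
  define a b where "a = u n" and "b = u (Suc n)"
  have I: "I \<in> sets lebesgue" by (simp add: I_def)
  have sub: "fun_space.subspace X1d"
    using \<open>fin_dim_subspace I X1d\<close> by (simp add: fin_dim_subspace_def)
  have lincomb: "(\<lambda>x. c * a x + d * b x) \<in> X1d" for c d
  proof -
    have "(\<lambda>x. c * a x) + (\<lambda>x. d * b x) \<in> X1d"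
      using sub \<open>u n \<in> X1d\<close> \<open>u (Suc n) \<in> X1d\<close>
      by (intro fun_space.subspace_add fun_space.subspace_scale) (simp_all add: a_def b_def)
    then show ?thesis by (simp add: plus_fun_def)
  qed
  have uh_eq: "uh = (\<lambda>x. 1/2 * a x + 1/2 * b x)"
    by (simp add: uh a_def b_def algebra_simps)
  have uhX: "uh \<in> X1 L"
    unfolding uh_eq using lincomb \<open>X1d \<subseteq> X1 L\<close> by blast
  \<comment> \<open>The increment \<open>b - a\<close>, used as the test function of the second relation.\<close>
  define v where "v = (\<lambda>x. (-1) * a x + 1 * b x)"
  have vX: "v \<in> X1d" unfolding v_def by (rule lincomb)
  have H: "a \<in> H1_space I" "b \<in> H1_space I"
    using \<open>u n \<in> X1d\<close> \<open>u (Suc n) \<in> X1d\<close> \<open>X1d \<subseteq> X1 L\<close>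
    by (auto simp: a_def b_def X1_def I_def)
  let ?W = "weak_deriv I"
  have Wuh: "AE x in lebesgue_on I. ?W uh x = 1/2 * ?W a x + 1/2 * ?W b x"
    using H unfolding uh_eq I_def by (rule weak_deriv_lincomb)
  have Wv: "AE x in lebesgue_on I. ?W v x = (-1) * ?W a x + 1 * ?W b x"
    using H unfolding v_def I_def by (rule weak_deriv_lincomb)
  have L2: "?W a \<in> L2_space I" "?W b \<in> L2_space I"
    using H by (simp_all add: I_def H1_space_has_weak_deriv(2))
  have "integral\<^sup>L (lebesgue_on I) (\<lambda>x. 1/2 * (?W b x)\<^sup>2) - integral\<^sup>L (lebesgue_on I) (\<lambda>x. 1/2 * (?W a x)\<^sup>2)
      = integral\<^sup>L (lebesgue_on I) (\<lambda>x. 1/2 * (?W b x)\<^sup>2 - 1/2 * (?W a x)\<^sup>2)"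
    using L2 by (intro Bochner_Integration.integral_diff[symmetric]) (simp_all add: L2_space_def)
  also have "\<dots> = bracket I (?W uh) (?W v)"
    unfolding bracket_def
  proof (rule integral_lebesgue_on_cong_AE(1)[OF _ I])
    show "AE x in lebesgue_on I. 1/2 * (?W b x)\<^sup>2 - 1/2 * (?W a x)\<^sup>2 = ?W uh x * ?W v x"
      using Wuh Wv by eventually_elim (simp only:, simp add: power2_eq_square field_simps)
  qed
  also have "\<dots> = bracket I r (?W v)"
    by (rule projection[OF vX, symmetric])
  also have "\<dots> = integral\<^sup>L (lebesgue_on I) (\<lambda>x. dt * ((?W b x - ?W a x) / dt * r x))"
    unfolding bracket_def
  proof (rule integral_lebesgue_on_cong_AE(1)[OF _ I])
    show "AE x in lebesgue_on I. r x * ?W v x = dt * ((?W b x - ?W a x) / dt * r x)"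
      using Wv by eventually_elim (use \<open>dt > 0\<close> in \<open>(simp only:, simp add: field_simps)\<close>)
  qed
  also have "\<dots> = dt * bracket I (\<lambda>x. (?W b x - ?W a x) / dt) r"
    by (simp add: bracket_def)
  also have "\<dots> = 0"
    using evolution[OF \<open>r \<in> X2d\<close>] advection_term_orthogonal[OF uhX _ \<open>L > 0\<close>, of r]
      \<open>r \<in> X2d\<close> \<open>X2d \<subseteq> X2 L\<close>
    by (auto simp: a_def b_def I_def)
  finally show ?thesis by (simp add: a_def b_def)
qed

end
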